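(* Let $A\in\{0,1\}^{m\times n}$ be the adjacency matrix of an unbalanced, left $d$-regular $(k,\varepsilon,d)$-expander graph with $\varepsilon \le 1/4$, and let $x\in\mathbb{R}^n$ be a dissociated signal with at most $k$ nonzero entries. Then Serial-$\ell_0$ and Parallel-$\ell_0$ with $\alpha=(1-2\varepsilon)d$ can recover $x$ from $y=Ax\in\mathbb{R}^m$ in $\mathcal{O}(dn\log k)$ operations.
   Context: Notation: $[n]=\{1,\dots,n\}$; $\operatorname{supp}(x)=\{i: x_i\ne 0\}$; $\|x\|_0=|\operatorname{supp}(x)|$; $a_j$ is the $j$-th column of $A$. It is assumed throughout that $m<n$ and $\|x\|_0<m$. Expander: a left $d$-regular bipartite graph $G=([n],[m],E)$ has left nodes $[n]$, right nodes $[m]$, and every left node has exactly $d$ neighbours; it is unbalanced if $m<n$. For $S\subset[n]$, $\mathcal{N}(S)\subset[m]$ is the set of right nodes adjacent to some element of $S$, and $\mathcal{N}(j)=\mathcal{N}(\{j\})$. An unbalanced, left $d$-regular bipartite graph $G$ is a $(k,\varepsilon,d)$-expander, where $\varepsilon\in(0,1)$, if $|\mathcal{N}(S)|>(1-\varepsilon)d|S|$ for every nonempty $S\subset[n]$ with $|S|\le k$. Its adjacency matrix $A\in\{0,1\}^{m\times n}$ has $A_{ij}=1$ if $i\in\mathcal{N}(j)$ and $A_{ij}=0$ otherwise. Dissociated: $x\in\mathbb{R}^n$ is dissociated if $\sum_{j\in T_1}x_j\neq\sum_{j\in T_2}x_j$ for all $T_1,T_2\subset\operatorname{supp}(x)$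 with $T_1\ne T_2$ (the empty set is allowed, with empty sum $0$). Algorithms. The input is $A$, $y\in\mathbb{R}^m$ and a threshold $\alpha\in(1,d]$; the output is $\hat x\in\mathbb{R}^n$ such that $y=A\hat x$. Both start from $\hat x=0$, $r=y$ and repeat the following while not converged. Parallel-$\ell_0$: compute $T=\{(j,\omega_j)\in[n]\times\mathbb{R}:\ \|r\|_0-\|r-\omega_j a_j\|_0\ge\alpha\}$; for every $(j,\omega_j)\in T$ set $\hat x_j\leftarrow\hat x_j+\omega_j$; then set $r\leftarrow y-A\hat x$. Serial-$\ell_0$: for each $j\in[n]$ in turn: compute $T=\{\omega_j\in\mathbb{R}:\ \|r\|_0-\|r-\omega_j a_j\|_0\ge\alpha\}$; for every $\omega_j\in T$ set $\hat x_j\leftarrow\hat x_j+\omega_j$; then set $r\leftarrow y-A\hat x$ (before moving to the next $j$).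
   Formalization: k ≥ 2 is assumed (for k = 1 columns may coincide, recovery fails, and log k = 0), and the constant in O(dn log k) may depend on ε and d, since a uniform one is false; the cost per sweep is O(dn) with an absolute constant and the number of sweeps is at most C(ε,d) log k. *)

theory Defs
  imports Complex_Main "Jordan_Normal_Form.Matrix" "HOL-Library.While_Combinator"
    "HOL-Library.Monad_Syntax"
begin

section \<open>Expander graphs and dissociated signals\<close>

text \<open>Node sets are \<open>{..<n}\<close> and \<open>{..<m}\<close>.  With edges \<open>E\<close> directed from left to right,
  the neighbourhood of a set \<open>S\<close> of left nodes is the relational image \<open>E `` S\<close>.\<close>

definition left_regular_bipartite :: "nat \<Rightarrow> nat \<Rightarrow> (nat \<times> nat) set \<Rightarrow> nat \<Rightarrow> bool" where
  "left_regular_bipartite m n E d \<longleftrightarrow>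
     E \<subseteq> {..<n} \<times> {..<m} \<and> (\<forall>j<n. card (E `` {j}) = d)"

definition expander :: "nat \<Rightarrow> nat \<Rightarrow> (nat \<times> nat) set \<Rightarrow> nat \<Rightarrow> real \<Rightarrow> nat \<Rightarrow> bool" where
  "expander m n E k \<epsilon> d \<longleftrightarrow>
     m < n \<and> left_regular_bipartite m n E d \<and> 0 < \<epsilon> \<and> \<epsilon> < 1 \<and>
     (\<forall>S. S \<subseteq> {..<n} \<longrightarrow> S \<noteq> {} \<longrightarrow> card S \<le> k \<longrightarrow>
        real (card (E `` S)) > (1 - \<epsilon>) * real d * real (card S))"

definition adjacency_matrix :: "nat \<Rightarrow> nat \<Rightarrow> (nat \<times> nat) set \<Rightarrow> real mat" where
  "adjacency_matrix m n E = mat m n (\<lambda>(i, j). if i \<in> E `` {j} then 1 else 0)"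

definition supp :: "real vec \<Rightarrow> nat set" where
  "supp v = {i. i < dim_vec v \<and> v $ i \<noteq> 0}"

definition l0 :: "real vec \<Rightarrow> nat" where
  "l0 v = card (supp v)"

definition dissociated :: "real vec \<Rightarrow> bool" where
  "dissociated x \<longleftrightarrow>
     (\<forall>T1 T2. T1 \<subseteq> supp x \<longrightarrow> T2 \<subseteq> supp x \<longrightarrow> T1 \<noteq> T2 \<longrightarrow>
        (\<Sum>j\<in>T1. x $ j) \<noteq> (\<Sum>j\<in>T2. x $ j))"


section \<open>The two algorithms\<close>

text \<open>The state is the pair of the current estimate and the current residual.\<close>

definition column_T :: "real mat \<Rightarrow> real \<Rightarrow> real vec \<Rightarrow> nat \<Rightarrow> real set" where
  "column_T A \<alpha> r j = {\<omega>. real (l0 r) - real (l0 (r - \<omega> \<cdot>\<^sub>v col A j)) \<ge> \<alpha>}"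

definition parallel_T :: "real mat \<Rightarrow> real \<Rightarrow> real vec \<Rightarrow> (nat \<times> real) set" where
  "parallel_T A \<alpha> r = {(j, \<omega>). j < dim_col A \<and> \<omega> \<in> column_T A \<alpha> r j}"

definition parallel_step ::
  "real mat \<Rightarrow> real vec \<Rightarrow> real \<Rightarrow> real vec \<times> real vec \<Rightarrow> real vec \<times> real vec" where
  "parallel_step A y \<alpha> = (\<lambda>(xh, r).
     let T = parallel_T A \<alpha> r;
         xh' = vec (dim_col A) (\<lambda>j. xh $ j + (\<Sum>\<omega> | (j, \<omega>) \<in> T. \<omega>))
     in (xh', y - A *\<^sub>v xh'))"

definition serial_update ::
  "real mat \<Rightarrow> real vec \<Rightarrow> real \<Rightarrow> nat \<Rightarrow> real vec \<times> real vec \<Rightarrow> real vec \<times> real vec" where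
  "serial_update A y \<alpha> j = (\<lambda>(xh, r).
     let T = column_T A \<alpha> r j;
         xh' = vec (dim_col A) (\<lambda>i. if i = j then xh $ i + (\<Sum>\<omega>\<in>T. \<omega>) else xh $ i)
     in (xh', y - A *\<^sub>v xh'))"

definition serial_step ::
  "real mat \<Rightarrow> real vec \<Rightarrow> real \<Rightarrow> real vec \<times> real vec \<Rightarrow> real vec \<times> real vec" where
  "serial_step A y \<alpha> = fold (serial_update A y \<alpha>) [0..<dim_col A]"

text \<open>An output has to satisfy \<open>y = A xh\<close>, so ``converged'' means that the residual is zero.
  The result is \<open>None\<close> if this never happens.\<close>

definition decode ::
  "(real mat \<Rightarrow> real vec \<Rightarrow> real \<Rightarrow> real vec \<times> real vec \<Rightarrow> real vec \<times> real vec) \<Rightarrow>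
   real mat \<Rightarrow> real vec \<Rightarrow> real \<Rightarrow> real vec option" where
  "decode step A y \<alpha> = map_option fst
     (while_option (\<lambda>(xh, r). r \<noteq> 0\<^sub>v (dim_row A)) (step A y \<alpha>) (0\<^sub>v (dim_col A), y))"

definition parallel_l0 :: "real mat \<Rightarrow> real vec \<Rightarrow> real \<Rightarrow> real vec option" where
  "parallel_l0 = decode parallel_step"

definition serial_l0 :: "real mat \<Rightarrow> real vec \<Rightarrow> real \<Rightarrow> real vec option" where
  "serial_l0 = decode serial_step"


section \<open>Counting operations\<close>

text \<open>A real RAM with unit cost, shallowly embedded: a computation is its result together with
  the number of operations spent.  An array access, an addition, a subtraction, a comparison,
  an allocated or copied array cell and every loop iteration cost one operation each;
  \<open>ret\<close> merely names values already computed.\<close>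

type_synonym 'a counted = "'a \<times> nat"

definition ret :: "'a \<Rightarrow> 'a counted" where
  "ret v = (v, 0)"

definition tick :: "'a \<Rightarrow> 'a counted" where
  "tick v = (v, 1)"

definition bind_counted :: "'a counted \<Rightarrow> ('a \<Rightarrow> 'b counted) \<Rightarrow> 'b counted" where
  "bind_counted p f = (fst (f (fst p)), snd p + snd (f (fst p)))"

adhoc_overloading Monad_Syntax.bind \<rightleftharpoons> bind_counted

definition read_at :: "'a list \<Rightarrow> nat \<Rightarrow> 'a counted" where
  "read_at a i = tick (a ! i)"

definition write_at :: "'a list \<Rightarrow> nat \<Rightarrow> 'a \<Rightarrow> 'a list counted" where
  "write_at a i v = tick (a[i := v])"

definition add :: "'a::plus \<Rightarrow> 'a \<Rightarrow> 'a counted" where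
  "add u v = tick (u + v)"

definition sub :: "'a::minus \<Rightarrow> 'a \<Rightarrow> 'a counted" where
  "sub u v = tick (u - v)"

definition equal :: "'a \<Rightarrow> 'a \<Rightarrow> bool counted" where
  "equal u v = tick (u = v)"

definition leq :: "'a::ord \<Rightarrow> 'a \<Rightarrow> bool counted" where
  "leq u v = tick (u \<le> v)"

definition new_array :: "nat \<Rightarrow> 'a \<Rightarrow> 'a list counted" where
  "new_array n v = (replicate n v, n)"

definition copy :: "'a list \<Rightarrow> 'a list counted" where
  "copy a = (a, length a)"

fun for_each :: "'a list \<Rightarrow> ('a \<Rightarrow> 's \<Rightarrow> 's counted) \<Rightarrow> 's \<Rightarrow> 's counted" where
  "for_each [] f s = tick s"
| "for_each (a # as) f s = do { b \<leftarrow> tick a; s' \<leftarrow> f b s; for_each as f s' }"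

text \<open>\<open>while_counted\<close> yields the final state, the number of executions of the body and the
  number of operations, including those of the final, failing test.\<close>

definition while_counted ::
  "('s \<Rightarrow> bool counted) \<Rightarrow> ('s \<Rightarrow> 's counted) \<Rightarrow> 's \<Rightarrow> ('s \<times> nat \<times> nat) option" where
  "while_counted test body s =
     map_option (\<lambda>(s, N, t). (s, N, t + snd (test s)))
       (while_option (\<lambda>(s, N, t). fst (test s))
          (\<lambda>(s, N, t). (fst (body s), N + 1, t + snd (test s) + snd (body s))) (s, 0, 0))"


section \<open>The algorithms as counted programs\<close>

text \<open>The matrix is stored column by column, as lists of the row indices of nonzero entries.\<close>

definition columns :: "real mat \<Rightarrow> nat list list" where
  "columns A = map (\<lambda>j. filter (\<lambda>i. A $$ (i, j) \<noteq> 0) [0..<dim_row A]) [0..<dim_col A]"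

text \<open>Boyer--Moore vote: if some value fills more than half of the cells \<open>is\<close> of \<open>r\<close>, it is
  the first component of the result.\<close>

definition majority :: "real list \<Rightarrow> nat list \<Rightarrow> (real \<times> int) counted" where
  "majority r is = for_each is (\<lambda>i (u, c). do {
       v \<leftarrow> read_at r i;
       z \<leftarrow> equal c 0;
       if z then ret (v, 1)
       else do {
         e \<leftarrow> equal v u;
         c' \<leftarrow> (if e then add c 1 else sub c 1);
         ret (u, c') } }) (0, 0)"

text \<open>For a 0/1 matrix, replacing \<open>r\<close> by \<open>r - \<omega> a\<^sub>j\<close> creates a zero at every neighbour of \<open>j\<close>
  where \<open>r\<close> equals \<open>\<omega>\<close> and, for nonzero \<open>\<omega>\<close>, destroys the zeros of \<open>r\<close> at the other ones.\<close>

definition score :: "real list \<Rightarrow> nat list \<Rightarrow> real \<Rightarrow> int counted" where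
  "score r is \<omega> = for_each is (\<lambda>i s. do {
       v \<leftarrow> read_at r i;
       z \<leftarrow> equal v 0;
       s' \<leftarrow> (if z then sub s 1 else ret s);
       e \<leftarrow> equal v \<omega>;
       if e then add s' 1 else ret s' }) 0"

definition passes :: "real list \<Rightarrow> real \<Rightarrow> nat list \<Rightarrow> real \<Rightarrow> bool counted" where
  "passes r \<alpha> is \<omega> = do { s \<leftarrow> score r is \<omega>; leq \<alpha> (real_of_int s) }"

text \<open>A passing value fills at least \<open>\<alpha>\<close> of the cells \<open>is\<close>.  If \<open>\<alpha>\<close> is at least half of their
  number, it is the value in the first cell or a strict majority among the other cells, so two
  candidates suffice.\<close>

definition column_scan :: "real list \<Rightarrow> real \<Rightarrow> nat list \<Rightarrow> real list counted" where
  "column_scan r \<alpha> is =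
     (case is of
        [] \<Rightarrow> tick []
      | i # is' \<Rightarrow> do {
          u \<leftarrow> read_at r i;
          (w, c) \<leftarrow> majority r is';
          p \<leftarrow> passes r \<alpha> is u;
          q \<leftarrow> passes r \<alpha> is w;
          e \<leftarrow> equal w u;
          us \<leftarrow> (if p then tick [u] else ret []);
          if q \<and> \<not> e then tick (w # us) else ret us })"

definition subtract_at :: "real list \<Rightarrow> nat list \<Rightarrow> real \<Rightarrow> real list counted" where
  "subtract_at r is v = for_each is (\<lambda>i r. do {
       u \<leftarrow> read_at r i;
       u' \<leftarrow> sub u v;
       write_at r i u' }) r"

definition add_at :: "real list \<Rightarrow> nat \<Rightarrow> real \<Rightarrow> real list counted" where
  "add_at xs j \<omega> = do { v \<leftarrow> read_at xs j; v' \<leftarrow> add v \<omega>; write_at xs j v' }"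

definition residual :: "nat list list \<Rightarrow> real list \<Rightarrow> real list \<Rightarrow> real list counted" where
  "residual cs y xs = do {
     r \<leftarrow> copy y;
     for_each [0..<length cs] (\<lambda>j r. do {
       is \<leftarrow> read_at cs j;
       v \<leftarrow> read_at xs j;
       subtract_at r is v }) r }"

definition parallel_sweep ::
  "nat list list \<Rightarrow> real list \<Rightarrow> real \<Rightarrow> real list \<times> real list \<Rightarrow> (real list \<times> real list) counted"
where
  "parallel_sweep cs y \<alpha> = (\<lambda>(xs, r). do {
     T \<leftarrow> for_each [0..<length cs] (\<lambda>j T. do {
            is \<leftarrow> read_at cs j;
            ws \<leftarrow> column_scan r \<alpha> is;
            for_each ws (\<lambda>\<omega> T. tick ((j, \<omega>) # T)) T }) [];
     xs' \<leftarrow> for_each T (\<lambda>(j, \<omega>) xs. add_at xs j \<omega>) xs;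
     r' \<leftarrow> residual cs y xs';
     ret (xs', r') })"

text \<open>The assignment \<open>r := y - A xh\<close> inside the serial loop is carried out incrementally, by
  subtracting \<open>\<omega> a\<^sub>j\<close> from the residual whenever \<open>\<omega>\<close> is added to the \<open>j\<close>-th entry.\<close>

definition serial_sweep ::
  "nat list list \<Rightarrow> real list \<Rightarrow> real \<Rightarrow> real list \<times> real list \<Rightarrow> (real list \<times> real list) counted"
where
  "serial_sweep cs y \<alpha> =
     for_each [0..<length cs] (\<lambda>j (xs, r). do {
       is \<leftarrow> read_at cs j;
       ws \<leftarrow> column_scan r \<alpha> is;
       for_each ws (\<lambda>\<omega> (xs, r). do {
         xs' \<leftarrow> add_at xs j \<omega>;
         r' \<leftarrow> subtract_at r is \<omega>;
         ret (xs', r') }) (xs, r) })"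

definition nonzero :: "real list \<Rightarrow> bool counted" where
  "nonzero r = for_each r (\<lambda>v b. do { z \<leftarrow> equal v 0; if z then ret b else ret True }) False"

text \<open>Output vector, number of sweeps, number of operations.\<close>

definition decode_counted ::
  "(nat list list \<Rightarrow> real list \<Rightarrow> real \<Rightarrow> real list \<times> real list \<Rightarrow> (real list \<times> real list) counted) \<Rightarrow>
   real mat \<Rightarrow> real vec \<Rightarrow> real \<Rightarrow> (real vec \<times> nat \<times> nat) option" where
  "decode_counted sweep A y \<alpha> =
     (let (s, t\<^sub>0) = do {
            xs \<leftarrow> new_array (dim_col A) 0;
            r \<leftarrow> copy (list_of_vec y);
            ret (xs, r) }
      in map_option (\<lambda>((xs, r), N, t). (vec_of_list xs, N, t\<^sub>0 + t))
           (while_counted (\<lambda>(xs, r). nonzero r) (sweep (columns A) (list_of_vec y) \<alpha>) s))"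

definition parallel_l0_counted ::
  "real mat \<Rightarrow> real vec \<Rightarrow> real \<Rightarrow> (real vec \<times> nat \<times> nat) option" where
  "parallel_l0_counted = decode_counted parallel_sweep"

definition serial_l0_counted ::
  "real mat \<Rightarrow> real vec \<Rightarrow> real \<Rightarrow> (real vec \<times> nat \<times> nat) option" where
  "serial_l0_counted = decode_counted serial_sweep"


section \<open>The counted programs carry out the sweeps of the algorithms\<close>

text \<open>The results \<open>parallel_sweep_refines\<close> and \<open>serial_sweep_refines\<close> hold for every 0/1 matrix
  whose columns have at most \<open>2 \<alpha>\<close> ones.\<close>

lemma fst_counted [simp]:
  "fst (ret v) = v" "fst (tick v) = v" "fst (bind_counted p f) = fst (f (fst p))"
  "fst (read_at a i) = a ! i" "fst (write_at a i v) = a[i := v]"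
  "fst (add u w) = u + w" "fst (sub u' w') = u' - w'" "fst (equal b c) = (b = c)"
  "fst (leq e g) = (e \<le> g)" "fst (new_array n v) = replicate n v" "fst (copy a) = a"
  by (simp_all add: ret_def tick_def bind_counted_def read_at_def write_at_def add_def sub_def
      equal_def leq_def new_array_def copy_def)

lemma fst_for_each [simp]: "fst (for_each as f s) = fold (\<lambda>a s. fst (f a s)) as s"
  by (induction as arbitrary: s) auto

lemma majority_aux:
  assumes "fold (\<lambda>i uc. fst (case uc of (u, c) \<Rightarrow> do {
       v \<leftarrow> read_at r i;
       z \<leftarrow> equal c 0;
       if z then ret (v, 1)
       else do {
         e \<leftarrow> equal v u;
         c' \<leftarrow> (if e then add c 1 else sub c 1);
         ret (u, c') } })) is (u0, c0) = (u, c :: int)" "c0 \<ge> 0"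
  and "2 * b \<le> l + (if w = u0 then c0 else - c0)"
  shows "c \<ge> 0 \<and> 2 * (b + int (count_list (map ((!) r) is) w)) \<le> l + int (length is) + (if w = u then c else - c)"
  using assms
proof (induction "is" arbitrary: u0 c0 b l)
  case Nil
  then show ?case by (auto split: if_splits)
next
  case (Cons i js)
  let ?v = "r ! i"
  let ?b = "if ?v = w then b + 1 else b"
  define s where "s = (if c0 = 0 then (?v, 1) else if ?v = u0 then (u0, c0 + 1) else (u0, c0 - 1))"
  obtain u1 c1 where s: "s = (u1, c1)" by (cases s)
  have "c1 \<ge> 0" using s Cons.prems(2) by (auto simp: s_def split: if_splits)
  moreover have "2 * ?b \<le> (l + 1) + (if w = u1 then c1 else - c1)"
    using s Cons.prems(2,3) by (auto simp: s_def split: if_splits)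
  ultimately show ?case
    using Cons.IH[of u1 c1 ?b "l + 1"] Cons.prems(1) s
    by (auto simp: s_def algebra_simps split: if_splits)
qed

lemma majority_correct:
  assumes "2 * count_list (map ((!) r) is) w > length is"
  shows "fst (fst (majority r is)) = w"
proof -
  obtain u c where uc: "fst (majority r is) = (u, c)" by (cases "fst (majority r is)")
  have "c \<ge> 0 \<and> 2 * (0 + int (count_list (map ((!) r) is) w)) \<le> 0 + int (length is) + (if w = u then c else - c)"
    by (rule majority_aux[where ?u0.0 = 0 and ?c0.0 = 0]) (use uc in \<open>auto simp: majority_def\<close>)
  then show ?thesis using assms uc by (auto split: if_splits)
qed

lemma score_aux:
  "fst (score r is \<omega>) = int (count_list (map ((!) r) is) \<omega>) - int (count_list (map ((!) r) is) 0)"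
proof -
  have "fold (\<lambda>i s. fst (do {
       v \<leftarrow> read_at r i;
       z \<leftarrow> equal v 0;
       s' \<leftarrow> (if z then sub s 1 else ret s);
       e \<leftarrow> equal v \<omega>;
       if e then add s' 1 else ret s' })) is s
     = s + int (count_list (map ((!) r) is) \<omega>) - int (count_list (map ((!) r) is) 0)" for s
    by (induction "is" arbitrary: s) auto
  from this[of 0] show ?thesis by (simp add: score_def)
qed

lemma fst_passes: "fst (passes r \<alpha> is \<omega>) \<longleftrightarrow>
   \<alpha> \<le> real (count_list (map ((!) r) is) \<omega>) - real (count_list (map ((!) r) is) 0)"
  by (simp add: passes_def score_aux)

lemma column_scan_correct:
  assumes "\<alpha> > 0" "real (length is) \<le> 2 * \<alpha>"
  shows "distinct (fst (column_scan r \<alpha> is))"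
    and "set (fst (column_scan r \<alpha> is)) = {\<omega>. fst (passes r \<alpha> is \<omega>)}"
proof -
  show "distinct (fst (column_scan r \<alpha> is))"
    by (auto simp: column_scan_def split: list.splits prod.splits)
  show "set (fst (column_scan r \<alpha> is)) = {\<omega>. fst (passes r \<alpha> is \<omega>)}"
  proof (cases "is")
    case Nil
    then show ?thesis using assms by (auto simp: column_scan_def fst_passes)
  next
    case (Cons i js)
    have cand: "\<omega> = r ! i \<or> \<omega> = fst (fst (majority r js))" if "fst (passes r \<alpha> is \<omega>)" for \<omega>
    proof (cases "\<omega> = r ! i")
      case False
      moreover have "\<alpha> \<le> real (count_list (map ((!) r) is) \<omega>)"
        using that by (simp add: fst_passes)
      ultimately have "length js < 2 * count_list (map ((!) r) js) \<omega>"
        using assms(2) Cons by auto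
      then show ?thesis by (simp add: majority_correct)
    qed simp
    show ?thesis using cand Cons
      by (auto simp: column_scan_def split: list.splits prod.splits if_splits) force+
  qed
qed

lemma sum_list_of_bool_count: "(\<Sum>i\<leftarrow>is. if f i = w then 1 else 0 :: real) = real (count_list (map f is) w)"
  by (induction "is") auto

lemma column_T_passes:
  assumes A: "A \<in> carrier_mat m n" "\<forall>i<m. \<forall>j<n. A $$ (i, j) \<in> {0, 1}"
    and r: "r \<in> carrier_vec m" and j: "j < n"
  shows "column_T A \<alpha> r j = {\<omega>. fst (passes (list_of_vec r) \<alpha> (columns A ! j) \<omega>)}"
proof -
  let ?is = "columns A ! j"
  have is_eq: "?is = filter (\<lambda>i. A $$ (i, j) \<noteq> 0) [0..<m]"
    using A j by (simp add: columns_def)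
  have l0_sum: "real (l0 v) = (\<Sum>i<m. if v $ i \<noteq> 0 then 1 else 0)" if "v \<in> carrier_vec m" for v
  proof -
    have "supp v = {i\<in>{..<m}. v $ i \<noteq> 0}" using that by (auto simp: supp_def)
    then have "real (l0 v) = (\<Sum>i\<in>{i\<in>{..<m}. v $ i \<noteq> 0}. 1)" by (simp add: l0_def)
    then show ?thesis by (simp only: sum.inter_filter[OF finite_lessThan])
  qed
  have "real (l0 r) - real (l0 (r - \<omega> \<cdot>\<^sub>v col A j))
     = real (count_list (map ((!) (list_of_vec r)) ?is) \<omega>)
       - real (count_list (map ((!) (list_of_vec r)) ?is) 0)" for \<omega>
  proof -
    have "real (l0 r) - real (l0 (r - \<omega> \<cdot>\<^sub>v col A j))
      = (\<Sum>i<m. (if r $ i \<noteq> 0 then 1 else 0) - (if r $ i \<noteq> \<omega> * A $$ (i, j) then 1 else 0))"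
      using A r j by (subst (1 2) l0_sum) (auto simp: sum_subtractf intro!: sum.cong)
    also have "\<dots> = (\<Sum>i\<in>{..<m}. if A $$ (i, j) \<noteq> 0
        then (if r $ i = \<omega> then 1 else 0) - (if r $ i = 0 then 1 else 0) else 0)"
      using A(2) j by (intro sum.cong) auto
    also have "\<dots> = (\<Sum>i | i < m \<and> A $$ (i, j) \<noteq> 0.
          (if r $ i = \<omega> then 1 else 0) - (if r $ i = 0 then 1 else 0))"
      by (simp only: sum.inter_filter[OF finite_lessThan, symmetric]) (simp add: lessThan_def)
    also have "\<dots> = (\<Sum>i\<leftarrow>?is. (if r $ i = \<omega> then 1 else 0) - (if r $ i = 0 then 1 else 0))"
      unfolding is_eq by (subst sum_list_distinct_conv_sum_set) (auto intro!: sum.cong)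
    also have "\<dots> = (\<Sum>i\<leftarrow>?is. if list_of_vec r ! i = \<omega> then 1 else 0)
        - (\<Sum>i\<leftarrow>?is. if list_of_vec r ! i = 0 then 1 else 0)"
      by (simp add: sum_list_subtractf list_of_vec_index)
    finally show ?thesis by (simp add: sum_list_of_bool_count)
  qed
  then show ?thesis by (simp add: column_T_def fst_passes)
qed

lemma vec_eq_list_of_vecI:
  "length a = dim_vec v \<Longrightarrow> (\<And>i. i < dim_vec v \<Longrightarrow> a ! i = v $ i) \<Longrightarrow> a = list_of_vec v"
  by (rule nth_equalityI) (auto simp: list_of_vec_index)

lemma subtract_at_list:
  assumes "distinct is" "set is \<subseteq> {..<length r}"
  shows "length (fst (subtract_at r is v)) = length r"
    and "i < length r \<Longrightarrow> fst (subtract_at r is v) ! i = (if i \<in> set is then r ! i - v else r ! i)"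
proof -
  have "length (fst (subtract_at r is v)) = length r \<and>
    (\<forall>i<length r. fst (subtract_at r is v) ! i = (if i \<in> set is then r ! i - v else r ! i))"
    using assms
  proof (induction "is" arbitrary: r)
    case Nil
    then show ?case by (simp add: subtract_at_def)
  next
    case (Cons k js)
    have "fst (subtract_at r (k # js) v) = fst (subtract_at (r[k := r ! k - v]) js v)"
      by (simp add: subtract_at_def)
    then show ?case using Cons.IH[of "r[k := r ! k - v]"] Cons.prems
      by (auto simp: nth_list_update)
  qed
  then show "length (fst (subtract_at r is v)) = length r"
    and "i < length r \<Longrightarrow> fst (subtract_at r is v) ! i = (if i \<in> set is then r ! i - v else r ! i)"
    by auto
qed

lemma columns_props:
  assumes "A \<in> carrier_mat m n"
  shows "length (columns A) = n"
    and "j < n \<Longrightarrow> distinct (columns A ! j)"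
    and "j < n \<Longrightarrow> set (columns A ! j) = {i. i < m \<and> A $$ (i, j) \<noteq> 0}"
  using assms by (auto simp: columns_def)

lemma subtract_at_vec:
  assumes A: "A \<in> carrier_mat m n" "\<forall>i<m. \<forall>j<n. A $$ (i, j) \<in> {0, 1}"
    and r: "r \<in> carrier_vec m" and j: "j < n"
  shows "fst (subtract_at (list_of_vec r) (columns A ! j) v) = list_of_vec (r - v \<cdot>\<^sub>v col A j)"
proof (rule vec_eq_list_of_vecI)
  note P = columns_props[OF A(1)] and S = subtract_at_list[where ?is = "columns A ! j" and r = "list_of_vec r" and v = v]
  have d: "distinct (columns A ! j)" "set (columns A ! j) \<subseteq> {..<length (list_of_vec r)}"
    using P j r by auto
  show "length (fst (subtract_at (list_of_vec r) (columns A ! j) v)) = dim_vec (r - v \<cdot>\<^sub>v col A j)"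
    using S(1)[OF d] A r by simp
  fix i assume "i < dim_vec (r - v \<cdot>\<^sub>v col A j)"
  then have i: "i < m" using A by simp
  then show "fst (subtract_at (list_of_vec r) (columns A ! j) v) ! i = (r - v \<cdot>\<^sub>v col A j) $ i"
    using S(2)[OF d, where i = i] A r j P(3)[OF j] by (auto simp: list_of_vec_index)
qed

lemma residual_vec:
  assumes A: "A \<in> carrier_mat m n" "\<forall>i<m. \<forall>j<n. A $$ (i, j) \<in> {0, 1}"
    and y: "y \<in> carrier_vec m" and x: "x \<in> carrier_vec n"
  shows "fst (residual (columns A) (list_of_vec y) (list_of_vec x)) = list_of_vec (y - A *\<^sub>v x)"
proof -
  let ?f = "\<lambda>j r. fst (subtract_at r (columns A ! j) (x $ j))"
  have "fold ?f [0..<k] (list_of_vec y) = list_of_vec (vec m (\<lambda>i. y $ i - (\<Sum>j<k. A $$ (i, j) * x $ j)))"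
    if "k \<le> n" for k
    using that
  proof (induction k)
    case 0
    have "y = vec m (\<lambda>i. y $ i - (\<Sum>j<0. A $$ (i, j) * x $ j))" using y by auto
    then show ?case by (metis fold_Nil id_apply upt_0)
  next
    case (Suc k)
    then have "fold ?f [0..<Suc k] (list_of_vec y)
      = list_of_vec (vec m (\<lambda>i. y $ i - (\<Sum>j<k. A $$ (i, j) * x $ j)) - x $ k \<cdot>\<^sub>v col A k)"
      using subtract_at_vec[OF A, of _ k] by (simp del: list_of_vec_vec)
    also have "vec m (\<lambda>i. y $ i - (\<Sum>j<k. A $$ (i, j) * x $ j)) - x $ k \<cdot>\<^sub>v col A k
      = vec m (\<lambda>i. y $ i - (\<Sum>j<Suc k. A $$ (i, j) * x $ j))"
      using A Suc.prems by (auto simp: algebra_simps)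
    finally show ?case .
  qed
  note this[of n]
  moreover have "vec m (\<lambda>i. y $ i - (\<Sum>j<n. A $$ (i, j) * x $ j)) = y - A *\<^sub>v x"
    using A y x by (auto simp: scalar_prod_def lessThan_atLeast0)
  ultimately have "fold ?f [0..<n] (list_of_vec y) = list_of_vec (y - A *\<^sub>v x)"
    by simp
  then show ?thesis
    by (simp add: residual_def columns_props(1)[OF A(1)] list_of_vec_index)
qed

lemma add_at_fold:
  assumes "distinct T" "fst ` set T \<subseteq> {..<length xs}"
  shows "length (fold (\<lambda>(j, \<omega>) xs. fst (add_at xs j \<omega>)) T xs) = length xs \<and>
    (\<forall>i<length xs. fold (\<lambda>(j, \<omega>) xs. fst (add_at xs j \<omega>)) T xs ! i
       = xs ! i + (\<Sum>\<omega> | (i, \<omega>) \<in> set T. \<omega>))"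
  using assms
proof (induction T arbitrary: xs)
  case Nil
  then show ?case by simp
next
  case (Cons p T)
  obtain j w where p: "p = (j, w)" by (cases p)
  have fin: "finite {\<omega>. (i, \<omega>) \<in> set T}" for i
    by (rule finite_subset[of _ "snd ` set T"]) force+
  have ins: "{\<omega>. (i, \<omega>) \<in> set (p # T)} = (if i = j then insert w {\<omega>. (i, \<omega>) \<in> set T} else {\<omega>. (i, \<omega>) \<in> set T})" for i
    using p by auto
  have sum: "(\<Sum>\<omega> | (i, \<omega>) \<in> set (p # T). \<omega>)
    = (if i = j then w else 0) + (\<Sum>\<omega> | (i, \<omega>) \<in> set T. \<omega>)" for i
     proof (cases "i = j")
    case True
    have nin: "w \<notin> {\<omega>. (j, \<omega>) \<in> set T}" using Cons.prems(1) p by auto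
    show ?thesis unfolding ins using True sum.insert[OF fin[of j] nin, of "\<lambda>\<omega>. \<omega>"] by simp
  next
    case False
    then show ?thesis unfolding ins by simp
  qed
  have upd: "fst (add_at xs j w) = xs[j := xs ! j + w]" by (simp add: add_at_def)
  have IH: "length (fold (\<lambda>(j, \<omega>) xs. fst (add_at xs j \<omega>)) T (xs[j := xs ! j + w])) = length xs \<and>
    (\<forall>i<length xs. fold (\<lambda>(j, \<omega>) xs. fst (add_at xs j \<omega>)) T (xs[j := xs ! j + w]) ! i
       = xs[j := xs ! j + w] ! i + (\<Sum>\<omega> | (i, \<omega>) \<in> set T. \<omega>))"
    using Cons.IH[of "xs[j := xs ! j + w]"] Cons.prems by auto
  show ?case unfolding sum using IH Cons.prems p upd by (simp add: nth_list_update)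
qed

lemma fold_Cons_pairs: "fold (\<lambda>\<omega> T. (j, \<omega>) # T) ws T = rev (map (Pair j) ws) @ T"
  by (induction ws arbitrary: T) auto

lemma parallel_sweep_refines:
  assumes A: "A \<in> carrier_mat m n" "\<forall>i<m. \<forall>j<n. A $$ (i, j) \<in> {0, 1}"
    and y: "y \<in> carrier_vec m" and x: "x \<in> carrier_vec n" and r: "r \<in> carrier_vec m"
    and \<alpha>: "\<alpha> > 0" "\<forall>j<n. real (length (columns A ! j)) \<le> 2 * \<alpha>"
  shows "map_prod vec_of_list vec_of_list
           (fst (parallel_sweep (columns A) (list_of_vec y) \<alpha> (list_of_vec x, list_of_vec r)))
         = parallel_step A y \<alpha> (x, r)"
proof -
  let ?ws = "\<lambda>j. fst (column_scan (list_of_vec r) \<alpha> (columns A ! j))"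
  define T where "T = fold (\<lambda>j T. rev (map (Pair j) (?ws j)) @ T) [0..<n] []"
  have ws: "distinct (?ws j)" "set (?ws j) = column_T A \<alpha> r j" if "j < n" for j
    using column_scan_correct[of \<alpha> "columns A ! j" "list_of_vec r"] \<alpha> that
      column_T_passes[OF A r that] by auto
  have "distinct (fold (\<lambda>j T. rev (map (Pair j) (?ws j)) @ T) [0..<k] []) \<and>
     set (fold (\<lambda>j T. rev (map (Pair j) (?ws j)) @ T) [0..<k] []) = {(j, \<omega>). j < k \<and> \<omega> \<in> column_T A \<alpha> r j}"
    if "k \<le> n" for k
    using that
  proof (induction k)
    case 0
    show ?case by simp
  next
    case (Suc k)
    then show ?case using ws[of k] by (auto simp: distinct_map inj_on_def less_Suc_eq)
  qed
  from this[of n] have T: "distinct T" "set T = parallel_T A \<alpha> r"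
    using A unfolding T_def parallel_T_def by auto
  let ?x' = "vec n (\<lambda>j. x $ j + (\<Sum>\<omega> | (j, \<omega>) \<in> parallel_T A \<alpha> r. \<omega>))"
  have "fst ` set T \<subseteq> {..<length (list_of_vec x)}"
    using T(2) A x by (auto simp: parallel_T_def)
  from add_at_fold[OF T(1) this]
  have x': "fold (\<lambda>(j, \<omega>) xs. fst (add_at xs j \<omega>)) T (list_of_vec x) = list_of_vec ?x'"
    using x T(2) by (intro vec_eq_list_of_vecI) (auto simp: list_of_vec_index simp del: list_of_vec_vec)
  have "fst (parallel_sweep (columns A) (list_of_vec y) \<alpha> (list_of_vec x, list_of_vec r))
    = (list_of_vec ?x', fst (residual (columns A) (list_of_vec y) (list_of_vec ?x')))"
    unfolding x'[symmetric] T_def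
    by (simp add: parallel_sweep_def fold_Cons_pairs columns_props(1)[OF A(1)] case_prod_unfold)
  then show ?thesis
    using A by (simp add: residual_vec[OF A y] vec_list parallel_step_def Let_def
        del: list_of_vec_vec vec_of_list_map)
qed

lemma serial_hits_fold:
  assumes A: "A \<in> carrier_mat m n" "\<forall>i<m. \<forall>j<n. A $$ (i, j) \<in> {0, 1}"
    and "x \<in> carrier_vec n" "r \<in> carrier_vec m" and j: "j < n"
  shows "fold (\<lambda>\<omega> (xs, r). (fst (add_at xs j \<omega>), fst (subtract_at r (columns A ! j) \<omega>)))
       ws (list_of_vec x, list_of_vec r)
     = (list_of_vec (x + sum_list ws \<cdot>\<^sub>v unit_vec n j), list_of_vec (r - sum_list ws \<cdot>\<^sub>v col A j))"
  using assms(3,4)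
proof (induction ws arbitrary: x r)
  case Nil
  then show ?case using A by (auto intro!: arg_cong[where f = list_of_vec])
next
  case (Cons w ws)
  have a: "fst (add_at (list_of_vec x) j w) = list_of_vec (x + w \<cdot>\<^sub>v unit_vec n j)"
    using Cons.prems j
    by (intro vec_eq_list_of_vecI) (auto simp: add_at_def list_of_vec_index nth_list_update)
  have s: "fst (subtract_at (list_of_vec r) (columns A ! j) w) = list_of_vec (r - w \<cdot>\<^sub>v col A j)"
    by (rule subtract_at_vec[OF A Cons.prems(2) j])
  have "x + w \<cdot>\<^sub>v unit_vec n j + sum_list ws \<cdot>\<^sub>v unit_vec n j = x + sum_list (w # ws) \<cdot>\<^sub>v unit_vec n j"
    "r - w \<cdot>\<^sub>v col A j - sum_list ws \<cdot>\<^sub>v col A j = r - sum_list (w # ws) \<cdot>\<^sub>v col A j"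
    using A Cons.prems j by (auto simp: algebra_simps)
  then show ?case
    using Cons.IH[of "x + w \<cdot>\<^sub>v unit_vec n j" "r - w \<cdot>\<^sub>v col A j"] A Cons.prems j
    by (simp add: a s)
qed

lemma serial_sweep_refines:
  assumes A: "A \<in> carrier_mat m n" "\<forall>i<m. \<forall>j<n. A $$ (i, j) \<in> {0, 1}"
    and y: "y \<in> carrier_vec m" and x: "x \<in> carrier_vec n" and r: "r = y - A *\<^sub>v x"
    and \<alpha>: "\<alpha> > 0" "\<forall>j<n. real (length (columns A ! j)) \<le> 2 * \<alpha>"
  shows "map_prod vec_of_list vec_of_list
           (fst (serial_sweep (columns A) (list_of_vec y) \<alpha> (list_of_vec x, list_of_vec r)))
         = serial_step A y \<alpha> (x, r)"
proof -
  let ?l = "map_prod list_of_vec list_of_vec"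
  let ?g = "\<lambda>j (xs, r). fold (\<lambda>\<omega> (xs, r). (fst (add_at xs j \<omega>), fst (subtract_at r (columns A ! j) \<omega>)))
       (fst (column_scan r \<alpha> (columns A ! j))) (xs, r)"
  define I where "I = (\<lambda>(x, r). x \<in> carrier_vec n \<and> r = y - A *\<^sub>v x)"
  have step: "?g j (?l s) = ?l (serial_update A y \<alpha> j s) \<and> I (serial_update A y \<alpha> j s)"
    if "j < n" "I s" for j s
  proof -
    obtain x r where s: "s = (x, r)" by (cases s)
    have x: "x \<in> carrier_vec n" and r: "r = y - A *\<^sub>v x" "r \<in> carrier_vec m"
      using that(2) A y by (auto simp: I_def s)
    let ?ws = "fst (column_scan (list_of_vec r) \<alpha> (columns A ! j))"
    have ws: "distinct ?ws" "set ?ws = column_T A \<alpha> r j"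
      using column_scan_correct[of \<alpha> "columns A ! j" "list_of_vec r"] \<alpha> that(1)
        column_T_passes[OF A r(2) that(1)] by auto
    have sum: "sum_list ?ws = (\<Sum>\<omega>\<in>column_T A \<alpha> r j. \<omega>)"
      using ws by (simp add: sum_list_distinct_conv_sum_set[where f = "\<lambda>x. x", simplified])
    define q where "q = sum_list ?ws"
    have q: "(\<Sum>\<omega>\<in>column_T A \<alpha> r j. \<omega>) = q" unfolding q_def by (rule sum[symmetric])
    have x': "x + q \<cdot>\<^sub>v unit_vec n j = vec n (\<lambda>i. if i = j then x $ i + q else x $ i)"
      using x that(1) by auto
    have "A *\<^sub>v unit_vec n j = col A j"
      using A that(1) by auto
    then have "A *\<^sub>v (x + q \<cdot>\<^sub>v unit_vec n j) = A *\<^sub>v x + q \<cdot>\<^sub>v col A j"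
      using A x that(1)
      by (simp add: mult_add_distrib_mat_vec[OF A(1) x] mult_mat_vec[OF A(1)])
    then have r': "r - q \<cdot>\<^sub>v col A j = y - A *\<^sub>v (x + q \<cdot>\<^sub>v unit_vec n j)"
      using A x y by (auto simp: r(1) algebra_simps)
    have "serial_update A y \<alpha> j s = (x + q \<cdot>\<^sub>v unit_vec n j, r - q \<cdot>\<^sub>v col A j)"
      using A unfolding r' x' serial_update_def s Let_def prod.case q by simp
    moreover have "?g j (?l s) = ?l (x + q \<cdot>\<^sub>v unit_vec n j, r - q \<cdot>\<^sub>v col A j)"
      using serial_hits_fold[OF A x r(2) that(1)] by (simp add: s q_def)
    ultimately show ?thesis using x r' by (simp add: I_def)
  qed
  have "fold ?g [0..<k] (?l (x, r)) = ?l (fold (serial_update A y \<alpha>) [0..<k] (x, r)) \<and>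
      I (fold (serial_update A y \<alpha>) [0..<k] (x, r))" if "k \<le> n" for k
    using that
  proof (induction k)
    case 0
    show ?case using x r by (simp add: I_def)
  next
    case (Suc k)
    then show ?case using step[of k "fold (serial_update A y \<alpha>) [0..<k] (x, r)"] by simp
  qed
  from this[of n] have "fold ?g [0..<n] (list_of_vec x, list_of_vec r) = ?l (serial_step A y \<alpha> (x, r))"
    using A by (simp add: serial_step_def)
  moreover have "fst (serial_sweep (columns A) (list_of_vec y) \<alpha> s) = fold ?g [0..<n] s" for s
    by (simp add: serial_sweep_def columns_props(1)[OF A(1)] case_prod_unfold)
  ultimately show ?thesis by (simp add: prod.map_comp comp_def vec_list map_prod_def case_prod_unfold)
qed

end

theory Submission
  imports Defs
begin

text \<open>Let \<open>S\<close> be the set of coordinates where the estimate still differs from \<open>x\<close>.  By dissociation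
  the residual at a right node determines the set of neighbours of that node in \<open>S\<close>.  Two distinct
  left nodes have fewer than \<open>2 \<epsilon> d \<le> (1 - 2 \<epsilon>) d\<close> common neighbours, so a value passing the test
  at \<open>j\<close> is seen at right nodes whose only neighbour in \<open>S\<close> is \<open>j\<close>, and it equals \<open>x\<^sub>j\<close>: no wrong update
  is ever made, and \<open>j \<in> S\<close> passes iff it has at least \<open>(1 - 2 \<epsilon>) d\<close> private neighbours.  Expansion
  makes the average number of private neighbours over \<open>S\<close> exceed this threshold, so a fraction of \<open>S\<close>
  depending only on \<open>\<epsilon>\<close> and \<open>d\<close> passes; in the serial sweep nodes stay passing while \<open>S\<close> shrinks.
  Hence \<open>card S\<close> decays geometrically and \<open>O(ln k)\<close> sweeps of \<open>O(d n)\<close> operations suffice.\<close>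

section \<open>Private neighbours in an expander\<close>

text \<open>The unique neighbours of expander theory, attributed to their owner
  \<open>j\<close>.\<close>

definition private_neighbours :: "('a \<times> 'b) set \<Rightarrow> 'a set \<Rightarrow> 'a \<Rightarrow> 'b set" where
  "private_neighbours E S j = {i. (j, i) \<in> E \<and> (\<forall>l\<in>S. (l, i) \<in> E \<longrightarrow> l = j)}"

lemma private_neighbours_subset: "private_neighbours E S j \<subseteq> E `` {j}"
  by (auto simp: private_neighbours_def)

lemma private_neighbours_antimono: "S' \<subseteq> S \<Longrightarrow> private_neighbours E S j \<subseteq> private_neighbours E S' j"
  by (auto simp: private_neighbours_def)

lemma twice_card_neighbours_le:
  fixes E :: "('a \<times> 'b) set"
  assumes "finite S" "finite (E `` S)"
  shows "2 * card (E `` S) \<le> (\<Sum>j\<in>S. card (E `` {j}) + card (private_neighbours E S j))"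
proof -
  let ?w = "\<lambda>j i. of_bool ((j, i) \<in> E) + of_bool (i \<in> private_neighbours E S j) :: nat"
  have two: "2 \<le> (\<Sum>j\<in>S. ?w j i)" if "i \<in> E `` S" for i
  proof -
    obtain j where j: "j \<in> S" "(j, i) \<in> E" using \<open>i \<in> E `` S\<close> by auto
    show ?thesis
    proof (cases "i \<in> private_neighbours E S j")
      case True
      then have "2 = ?w j i" using j by simp
      also have "\<dots> \<le> (\<Sum>j\<in>S. ?w j i)" by (intro member_le_sum assms j) simp
      finally show ?thesis .
    next
      case False
      then obtain l where l: "l \<in> S" "(l, i) \<in> E" "l \<noteq> j"
        using j by (auto simp: private_neighbours_def)
      then have "2 \<le> (\<Sum>j\<in>{j, l}. ?w j i)" using j by simp
      also have "\<dots> \<le> (\<Sum>j\<in>S. ?w j i)"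
        by (intro sum_mono2 assms) (use j l in auto)
      finally show ?thesis .
    qed
  qed
  have "2 * card (E `` S) = (\<Sum>i\<in>E `` S. 2)" by simp
  also have "\<dots> \<le> (\<Sum>i\<in>E `` S. \<Sum>j\<in>S. ?w j i)" by (intro sum_mono two)
  also have "\<dots> = (\<Sum>j\<in>S. \<Sum>i\<in>E `` S. ?w j i)" by (rule sum.swap)
  also have "\<dots> = (\<Sum>j\<in>S. card (E `` {j}) + card (private_neighbours E S j))"
  proof (rule sum.cong[OF refl])
    fix j assume "j \<in> S"
    then have "E `` S \<inter> {i. (j, i) \<in> E} = E `` {j}"
      "E `` S \<inter> private_neighbours E S j = private_neighbours E S j"
      by (auto simp: private_neighbours_def)
    then show "(\<Sum>i\<in>E `` S. ?w j i) = card (E `` {j}) + card (private_neighbours E S j)"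
      using assms(2) by (simp add: sum.distrib Int_def)
  qed
  finally show ?thesis .
qed

lemma expander_props:
  assumes "expander m n E k \<epsilon> d"
  shows "j < n \<Longrightarrow> card (E `` {j}) = d" "E `` S \<subseteq> {..<m}" "finite (E `` S)"
proof -
  show sub: "E `` S \<subseteq> {..<m}"
    using assms by (auto simp: expander_def left_regular_bipartite_def)
  then show "finite (E `` S)" by (rule finite_subset) simp
qed (use assms in \<open>auto simp: expander_def left_regular_bipartite_def\<close>)

lemma sum_private_neighbours_greater:
  assumes E: "expander m n E k \<epsilon> d" and S: "S \<subseteq> {..<n}" "S \<noteq> {}" "card S \<le> k"
  shows "(1 - 2 * \<epsilon>) * real d * real (card S) < real (\<Sum>j\<in>S. card (private_neighbours E S j))"
proof -
  have "finite S" using S(1) finite_subset by blast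
  from twice_card_neighbours_le[OF this expander_props(3)[OF E]]
  have "2 * card (E `` S) \<le> (\<Sum>j\<in>S. card (E `` {j})) + (\<Sum>j\<in>S. card (private_neighbours E S j))"
    by (simp add: sum.distrib)
  moreover have "(\<Sum>j\<in>S. card (E `` {j})) = card S * d"
    using expander_props(1)[OF E] S(1) by (simp add: subset_iff)
  ultimately have "2 * card (E `` S) \<le> card S * d + (\<Sum>j\<in>S. card (private_neighbours E S j))"
    by simp
  then have "2 * real (card (E `` S)) \<le> real (card S) * real d + real (\<Sum>j\<in>S. card (private_neighbours E S j))"
    unfolding of_nat_mult[symmetric] of_nat_add[symmetric] by linarith
  moreover have "(1 - \<epsilon>) * real d * real (card S) < real (card (E `` S))"
    using E S by (simp add: expander_def)
  ultimately show ?thesis by (simp add: algebra_simps)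
qed

text \<open>As the number of private neighbours is an integer, a node that misses the threshold
  \<open>\<alpha> = (1 - 2 \<epsilon>) d\<close> misses it by at least \<open>\<alpha> - \<lceil>\<alpha>\<rceil> + 1\<close>.\<close>

definition contraction :: "real \<Rightarrow> nat \<Rightarrow> real" where
  "contraction \<epsilon> d = (let \<alpha> = (1 - 2 * \<epsilon>) * real d; \<delta> = \<alpha> - real_of_int \<lceil>\<alpha>\<rceil> + 1
     in (real d - \<alpha>) / (real d - \<alpha> + \<delta>))"

text \<open>The numerator is d - \<alpha> = 2 \<epsilon> d. Positivity matters because the number of
  sweeps is later bounded through the logarithm of this factor.\<close>

lemma contraction_bounds:
  assumes "0 < \<epsilon>" "0 < d"
  shows "0 < contraction \<epsilon> d" "contraction \<epsilon> d < 1"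
proof -
  let ?\<alpha> = "(1 - 2 * \<epsilon>) * real d"
  have "0 < real d - ?\<alpha>" using assms by (simp add: algebra_simps)
  moreover have "0 < ?\<alpha> - real_of_int \<lceil>?\<alpha>\<rceil> + 1" by linarith
  ultimately show "0 < contraction \<epsilon> d" "contraction \<epsilon> d < 1"
    unfolding contraction_def Let_def by (simp_all add: divide_simps)
qed

text \<open>A Markov-type argument: a node above the threshold owns at most d private neighbours,
  one below it at most \<lceil>\<alpha>\<rceil> - 1 = \<alpha> - \<delta>, yet the total exceeds
  \<alpha> |S|. Solving for the number of nodes below gives the quotient in
  \<open>contraction\<close>.\<close>

lemma few_nodes_below_threshold:
  assumes E: "expander m n E k \<epsilon> d" and S: "S \<subseteq> {..<n}" "card S \<le> k" and d: "0 < d"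
  shows "real (card {j\<in>S. real (card (private_neighbours E S j)) < (1 - 2 * \<epsilon>) * real d})
    \<le> contraction \<epsilon> d * real (card S)"
proof (cases "S = {}")
  case False
  define \<alpha> where "\<alpha> = (1 - 2 * \<epsilon>) * real d"
  define \<delta> where "\<delta> = \<alpha> - real_of_int \<lceil>\<alpha>\<rceil> + 1"
  let ?u = "\<lambda>j. card (private_neighbours E S j)"
  define Q where "Q = {j\<in>S. real (?u j) < \<alpha>}"
  have fin: "finite S" using S(1) finite_subset by blast
  have "0 < \<epsilon>" using E by (simp add: expander_def)
  then have pos: "0 < real d - \<alpha>" using d by (simp add: \<alpha>_def algebra_simps)
  have \<delta>: "0 < \<delta>" unfolding \<delta>_def by linarith
  have le: "real (?u j) \<le> real d - (if j \<in> Q then real d - \<alpha> + \<delta> else 0)" if "j \<in> S" for j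
  proof (cases "j \<in> Q")
    case True
    then have "int (?u j) < \<lceil>\<alpha>\<rceil>" by (simp add: Q_def less_ceiling_iff)
    then have "real (?u j) \<le> real_of_int \<lceil>\<alpha>\<rceil> - 1" by linarith
    then show ?thesis using True by (simp add: \<delta>_def)
  next
    case False
    have "j < n" using that S(1) by auto
    then show ?thesis using False
      card_mono[OF expander_props(3)[OF E] private_neighbours_subset[of E S j]]
      expander_props(1)[OF E, of j] by simp
  qed
  have "\<alpha> * real (card S) < (\<Sum>j\<in>S. real (?u j))"
    using sum_private_neighbours_greater[OF E S(1) False S(2)] by (simp add: \<alpha>_def)
  also have "\<dots> \<le> (\<Sum>j\<in>S. real d - (if j \<in> Q then real d - \<alpha> + \<delta> else 0))"
    by (intro sum_mono le)
  also have "\<dots> = real d * real (card S) - (real d - \<alpha> + \<delta>) * real (card Q)"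
  proof -
    have "S \<inter> Q = Q" by (auto simp: Q_def)
    then show ?thesis using fin by (simp add: sum_subtractf sum.If_cases)
  qed
  finally have "(real d - \<alpha> + \<delta>) * real (card Q) \<le> (real d - \<alpha>) * real (card S)"
    by (simp add: algebra_simps)
  then have "real (card Q) \<le> (real d - \<alpha>) / (real d - \<alpha> + \<delta>) * real (card S)"
    using pos \<delta> by (simp add: pos_le_divide_eq mult.commute)
  then show ?thesis by (simp only: contraction_def Let_def Q_def \<alpha>_def \<delta>_def)
qed simp

text \<open>Inclusion-exclusion turns the expansion of the pair \<open>{j, l}\<close> into 2 d - 2
  (1 - \<epsilon>) d. The expander property covers pairs because \<open>2 \<le> k\<close>.\<close>

lemma common_neighbours_less:
  assumes E: "expander m n E k \<epsilon> d" and "2 \<le> k" and jl: "j < n" "l < n" "j \<noteq> l"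
  shows "real (card (E `` {j} \<inter> E `` {l})) < 2 * \<epsilon> * real d"
proof -
  have "card {j, l} = 2" using jl by simp
  then have "(1 - \<epsilon>) * real d * 2 < real (card (E `` {j, l}))"
    using E[unfolded expander_def] assms(2) jl by (metis (no_types, lifting) empty_subsetI
        insert_not_empty insert_subset lessThan_iff of_nat_numeral)
  moreover have "E `` {j, l} = E `` {j} \<union> E `` {l}" by auto
  then have "card (E `` {j, l}) + card (E `` {j} \<inter> E `` {l}) = d + d"
    using card_Un_Int[of "E `` {j}" "E `` {l}"] expander_props[OF E] jl by simp
  then have "real (card (E `` {j, l})) + real (card (E `` {j} \<inter> E `` {l})) = real d + real d"
    unfolding of_nat_add[symmetric] by (simp only:)
  ultimately show ?thesis by (simp add: algebra_simps)
qed

section \<open>The sweeps resolve a fixed fraction of the support\<close>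

lemma count_list_map_distinct:
  "distinct xs \<Longrightarrow> count_list (map f xs) w = card {i \<in> set xs. f i = w}"
proof (induction xs)
  case (Cons a xs)
  have "{i \<in> set (a # xs). f i = w} = (if f a = w then insert a {i \<in> set xs. f i = w} else {i \<in> set xs. f i = w})"
    by auto
  then show ?case using Cons by simp
qed simp

lemma dissociated_sum_eq_iff:
  assumes "dissociated x" "S \<subseteq> supp x" "T \<subseteq> supp x"
  shows "(\<Sum>j\<in>S. x $ j) = (\<Sum>j\<in>T. x $ j) \<longleftrightarrow> S = T"
  using assms by (auto simp: dissociated_def)

section \<open>The recovery problem and its threshold\<close>

locale sparse_recovery =
  fixes m n k d :: nat and E :: "(nat \<times> nat) set" and \<epsilon> :: real and x :: "real vec"
  assumes expander: "expander m n E k \<epsilon> d" and eps_le: "\<epsilon> \<le> 1/4" and k_ge: "2 \<le> k"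
    and x_carrier: "x \<in> carrier_vec n" and dissociated: "dissociated x" and sparse: "l0 x \<le> k"
begin

definition A :: "real mat" where "A = adjacency_matrix m n E"

definition y :: "real vec" where "y = A *\<^sub>v x"

definition \<alpha> :: real where "\<alpha> = (1 - 2 * \<epsilon>) * real d"

definition unresolved :: "real vec \<Rightarrow> nat set" where
  "unresolved xh = {j. j < n \<and> xh $ j \<noteq> x $ j}"

text \<open>The invariant of both iterations: an entry of the estimate is either correct or still
  has its initial value 0.\<close>

definition consistent :: "real vec \<times> real vec \<Rightarrow> bool" where
  "consistent = (\<lambda>(xh, r). xh \<in> carrier_vec n \<and> r = y - A *\<^sub>v xh \<and> (\<forall>j\<in>unresolved xh. xh $ j = 0))"

lemma A_props: "A \<in> carrier_mat m n" "\<forall>i<m. \<forall>j<n. A $$ (i, j) \<in> {0, 1}"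
  and A_entry: "i < m \<Longrightarrow> j < n \<Longrightarrow> A $$ (i, j) = of_bool ((j, i) \<in> E)"
  by (auto simp: A_def adjacency_matrix_def)

lemma y_carrier: "y \<in> carrier_vec m"
  using A_props(1) x_carrier by (simp add: y_def)

lemma m_less_n: "m < n" and eps_pos: "0 < \<epsilon>"
  using expander by (auto simp: expander_def)

text \<open>Expansion is strict, so already the singleton \<open>{0}\<close> would violate it for d
  = 0.\<close>

lemma d_pos: "0 < d"
proof -
  have "{0} \<subseteq> {..<n}" "{0::nat} \<noteq> {}" "card {0::nat} \<le> k" using m_less_n k_ge by auto
  then have "(1 - \<epsilon>) * real d * real (card {0::nat}) < real (card (E `` {0}))"
    using expander unfolding expander_def by blast
  then show ?thesis using expander_props(1)[OF expander, of 0] m_less_n by (cases "d = 0") auto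
qed

text \<open>Everything follows from 4 \<epsilon> d \<le> d. The second bound makes \<alpha> exceed
  every number of common neighbours; the third ensures that the two candidates of
  \<open>column_scan\<close> suffice.\<close>

lemma alpha_pos: "0 < \<alpha>" and two_eps_d_le_alpha: "2 * \<epsilon> * real d \<le> \<alpha>" and d_le_two_alpha: "real d \<le> 2 * \<alpha>"
proof -
  have "4 * \<epsilon> * real d \<le> 1 * real d" by (rule mult_right_mono) (use eps_le in auto)
  then show "2 * \<epsilon> * real d \<le> \<alpha>" "real d \<le> 2 * \<alpha>"
    by (simp_all add: \<alpha>_def algebra_simps)
  then show "0 < \<alpha>" using d_pos by linarith
qed

lemma set_columns: "j < n \<Longrightarrow> set (columns A ! j) = E `` {j}"
  using columns_props(3)[OF A_props(1), of j] A_entry expander_props(2)[OF expander, of "{j}"] by auto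

lemma length_columns: "j < n \<Longrightarrow> length (columns A ! j) = d"
  using columns_props(2)[OF A_props(1), of j] set_columns[of j] expander_props(1)[OF expander, of j]
  by (metis distinct_card)

lemma column_length_le: "\<forall>j<n. real (length (columns A ! j)) \<le> 2 * \<alpha>"
  using length_columns d_le_two_alpha by simp

text \<open>Subtracting \<omega> times the column creates zeros where the residual equals \<omega>
  and destroys existing ones. For \<omega> = 0 the two counts cancel, so the formula covers this
  case too.\<close>

lemma column_T_iff:
  assumes r: "r \<in> carrier_vec m" and j: "j < n"
  shows "\<omega> \<in> column_T A \<alpha> r j \<longleftrightarrow>
    \<alpha> \<le> real (card {i\<in>E `` {j}. r $ i = \<omega>}) - real (card {i\<in>E `` {j}. r $ i = 0})"
proof -
  have "{i\<in>E `` {j}. list_of_vec r ! i = w} = {i\<in>E `` {j}. r $ i = w}" for w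
    using expander_props(2)[OF expander, of "{j}"] r by (auto simp: list_of_vec_index)
  then show ?thesis
    unfolding column_T_passes[OF A_props r j] mem_Collect_eq fst_passes
      count_list_map_distinct[OF columns_props(2)[OF A_props(1) j]] set_columns[OF j] by simp
qed

section \<open>The residual as a family of subset sums\<close>

lemma consistent_initial: "consistent (0\<^sub>v n, y)"
  using y_carrier A_props(1) by (auto simp: consistent_def unresolved_def)

lemma unresolved_subset_supp:
  assumes "consistent (xh, r)"
  shows "unresolved xh \<subseteq> supp x"
  using assms x_carrier by (auto simp: consistent_def unresolved_def supp_def)

lemma card_supp_le: "card (supp x) \<le> k" "finite (supp x)"
  using sparse by (auto simp: l0_def supp_def)

lemma card_unresolved_le: "consistent (xh, r) \<Longrightarrow> card (unresolved xh) \<le> k"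
  using card_mono[OF card_supp_le(2) unresolved_subset_supp] card_supp_le(1) by force

lemma finite_unresolved: "finite (unresolved xh)"
  by (simp add: unresolved_def)

lemma consistent_carrier:
  assumes "consistent (xh, r)"
  shows "xh \<in> carrier_vec n" "r \<in> carrier_vec m"
  using assms y_carrier A_props(1) by (auto simp: consistent_def)

text \<open>Correct coordinates cancel in the difference of the two products, and unresolved ones
  have estimate 0, so each contributes its full value \<open>x $ j\<close>.\<close>

lemma residual_entry:
  assumes "consistent (xh, r)" "i < m"
  shows "r $ i = (\<Sum>j | j \<in> unresolved xh \<and> (j, i) \<in> E. x $ j)"
proof -
  have xh: "xh \<in> carrier_vec n" and r: "r = y - A *\<^sub>v xh"
    and zero: "\<And>j. j \<in> unresolved xh \<Longrightarrow> xh $ j = 0"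
    using assms(1) by (auto simp: consistent_def)
  have "r $ i = (\<Sum>j<n. A $$ (i, j) * x $ j) - (\<Sum>j<n. A $$ (i, j) * xh $ j)"
    using assms(2) A_props(1) xh x_carrier
    by (simp add: r y_def scalar_prod_def lessThan_atLeast0)
  also have "\<dots> = (\<Sum>j<n. if j \<in> unresolved xh \<and> (j, i) \<in> E then x $ j else 0)"
    unfolding sum_subtractf[symmetric]
    by (intro sum.cong) (use A_entry[OF assms(2)] zero in \<open>auto simp: unresolved_def\<close>)
  also have "\<dots> = (\<Sum>j | j < n \<and> j \<in> unresolved xh \<and> (j, i) \<in> E. x $ j)"
    by (simp add: sum.If_cases Int_def)
  also have "{j. j < n \<and> j \<in> unresolved xh \<and> (j, i) \<in> E} = {j. j \<in> unresolved xh \<and> (j, i) \<in> E}"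
    by (auto simp: unresolved_def)
  finally show ?thesis .
qed

text \<open>Dissociation makes subset sums over \<open>supp x\<close> injective. Taking
  \<open>T\<close> empty describes a vanishing entry, taking \<open>T = {j}\<close> an entry at a
  private neighbour of an unresolved \<open>j\<close>.\<close>

lemma residual_entry_eq_iff:
  assumes c: "consistent (xh, r)" and i: "i < m" and T: "T \<subseteq> supp x"
  shows "r $ i = (\<Sum>j\<in>T. x $ j) \<longleftrightarrow> {j. j \<in> unresolved xh \<and> (j, i) \<in> E} = T"
  unfolding residual_entry[OF c i]
  by (rule dissociated_sum_eq_iff[OF dissociated]) (use unresolved_subset_supp[OF c] T in auto)

text \<open>The core of correctness: \<open>only\<close> excludes every wrong value and every
  resolved column, and \<open>hit\<close> computes the score of the right value exactly.\<close>

lemma column_T_eq: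
  assumes c: "consistent (xh, r)" and j: "j < n"
  shows "column_T A \<alpha> r j =
    (if j \<in> unresolved xh \<and> \<alpha> \<le> real (card (private_neighbours E (unresolved xh) j)) then {x $ j} else {})"
proof -
  let ?S = "unresolved xh"
  let ?P = "\<lambda>i. {l. l \<in> ?S \<and> (l, i) \<in> E}"
  note iff = column_T_iff[OF consistent_carrier(2)[OF c] j]
  have lt: "i < m" if "i \<in> E `` {l}" for i l
    using that expander_props(2)[OF expander, of "{l}"] by auto
  have only: "\<omega> = x $ j \<and> j \<in> ?S" if "\<omega> \<in> column_T A \<alpha> r j" for \<omega>
  proof -
    let ?C = "{i\<in>E `` {j}. r $ i = \<omega>}"
    \<comment> \<open>For \<omega> = 0 the two counts agree and the score 0 lies below
      \<alpha>.\<close>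
    have C: "\<alpha> \<le> real (card ?C)" and "\<omega> \<noteq> 0"
      using that alpha_pos by (auto simp: iff)
    have "?C \<noteq> {}"
    proof
      assume "?C = {}"
      then have "\<alpha> \<le> 0" using C by (metis card.empty of_nat_0)
      then show False using alpha_pos by simp
    qed
    then obtain i where i: "i \<in> E `` {j}" "r $ i = \<omega>" by auto
    have w: "\<omega> = (\<Sum>l\<in>?P i. x $ l)" using residual_entry[OF c lt[OF i(1)]] i(2) by simp
    \<comment> \<open>All places in \<open>?C\<close> show the same subset sum, hence see the same
      unresolved nodes. If one of these were \<open>l \<noteq> j\<close>, then \<open>?C\<close>
      would consist of common neighbours of \<open>l\<close> and \<open>j\<close>, of which there
      are fewer than \<alpha>.\<close>
    have "l = j" if l: "l \<in> ?P i" for l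
    proof (rule ccontr)
      assume "l \<noteq> j"
      moreover have "l < n" using l by (auto simp: unresolved_def)
      ultimately have "real (card (E `` {l} \<inter> E `` {j})) < \<alpha>"
        using common_neighbours_less[OF expander k_ge _ j] two_eps_d_le_alpha by fastforce
      have "?P i \<subseteq> supp x" using unresolved_subset_supp[OF c] by auto
      then have "?P i' = ?P i" if "i' \<in> ?C" for i'
        using residual_entry_eq_iff[OF c, of i' "?P i"] lt[of i' j] that w by simp
      then have "?C \<subseteq> E `` {l} \<inter> E `` {j}" using l by blast
      then have "card ?C \<le> card (E `` {l} \<inter> E `` {j})"
        by (intro card_mono finite_Int) (simp_all add: expander_props(3)[OF expander])
      then show False using C \<open>real (card (E `` {l} \<inter> E `` {j})) < \<alpha>\<close> by linarith
    qed
    moreover have "?P i \<noteq> {}" using w \<open>\<omega> \<noteq> 0\<close> by (metis sum.empty)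
    ultimately have "?P i = {j}" by blast
    then show ?thesis using w by auto
  qed
  have hit: "x $ j \<in> column_T A \<alpha> r j \<longleftrightarrow> \<alpha> \<le> real (card (private_neighbours E ?S j))"
    if jS: "j \<in> ?S"
  proof -
    have js: "{j} \<subseteq> supp x" using unresolved_subset_supp[OF c] jS by auto
    \<comment> \<open>An unresolved \<open>j\<close> takes part in the sum at each of its
      neighbours, so no zero can be destroyed and the penalty term vanishes.\<close>
    have "r $ i = x $ j \<longleftrightarrow> ?P i = {j}" "r $ i \<noteq> 0" if "i \<in> E `` {j}" for i
      using residual_entry_eq_iff[OF c lt[OF that] js]
        residual_entry_eq_iff[OF c lt[OF that] empty_subsetI] that jS by auto
    then have "{i\<in>E `` {j}. r $ i = x $ j} = private_neighbours E ?S j"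
      "{i\<in>E `` {j}. r $ i = 0} = {}"
      using jS by (auto simp: private_neighbours_def)
    then show ?thesis by (simp only: iff card.empty of_nat_0 diff_zero)
  qed
  show ?thesis using only hit by auto
qed

section \<open>Effect of a sweep on the unresolved coordinates\<close>

definition resolvable :: "nat set \<Rightarrow> nat set" where
  "resolvable S = {j\<in>S. \<alpha> \<le> real (card (private_neighbours E S j))}"

text \<open>Resolving other nodes only enlarges the private neighbourhood of \<open>j\<close>. In a
  serial sweep this keeps \<open>j\<close> resolvable until its turn comes.\<close>

lemma resolvable_mono:
  assumes "j \<in> resolvable S" "j \<in> S'" "S' \<subseteq> S"
  shows "j \<in> resolvable S'"
proof -
  have "finite (private_neighbours E S' j)"
    using private_neighbours_subset expander_props(3)[OF expander] finite_subset by metis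
  then have "card (private_neighbours E S j) \<le> card (private_neighbours E S' j)"
    using private_neighbours_antimono[OF assms(3)] by (rule card_mono)
  then show ?thesis using assms(1,2) by (auto simp: resolvable_def)
qed

lemma card_unresolvable_le:
  assumes "consistent (xh, r)"
  shows "real (card (unresolved xh - resolvable (unresolved xh))) \<le> contraction \<epsilon> d * real (card (unresolved xh))"
proof -
  have "unresolved xh \<subseteq> {..<n}" by (auto simp: unresolved_def)
  from few_nodes_below_threshold[OF expander this card_unresolved_le[OF assms] d_pos]
  show ?thesis by (simp add: resolvable_def \<alpha>_def set_diff_eq not_le conj_disj_distribL cong: conj_cong)
qed

text \<open>The common core of both updates: overwriting entries by their true values leaves the
  other unresolved entries at 0, so the invariant survives.\<close>

lemma resolve:
  assumes c: "consistent (xh, r)" and R: "R \<subseteq> unresolved xh" and v: "v \<in> carrier_vec n"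
    and entry: "\<And>i. i < n \<Longrightarrow> v $ i = (if i \<in> R then x $ i else xh $ i)"
  shows "consistent (v, y - A *\<^sub>v v)" "unresolved v = unresolved xh - R"
proof -
  show S: "unresolved v = unresolved xh - R"
    using entry by (auto simp: unresolved_def split: if_splits)
  have "v $ i = 0" if "i \<in> unresolved v" for i
    using that[unfolded S] entry[of i] c by (auto simp: consistent_def unresolved_def)
  then show "consistent (v, y - A *\<^sub>v v)" using v by (simp add: consistent_def)
qed

lemma parallel_step_resolves:
  assumes c: "consistent (xh, r)"
  shows "consistent (parallel_step A y \<alpha> (xh, r))"
    "unresolved (fst (parallel_step A y \<alpha> (xh, r))) = unresolved xh - resolvable (unresolved xh)"
proof -
  let ?S = "unresolved xh"
  let ?x = "vec n (\<lambda>j. xh $ j + (\<Sum>\<omega> | (j, \<omega>) \<in> parallel_T A \<alpha> r. \<omega>))"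
  \<comment> \<open>The algorithm adds \<open>x $ j\<close> to the old entry; the result is
    \<open>x $ j\<close> because the old entry is 0.\<close>
  have zero: "xh $ j = 0" if "j \<in> ?S" for j using c that by (auto simp: consistent_def)
  have step: "parallel_step A y \<alpha> (xh, r) = (?x, y - A *\<^sub>v ?x)"
    using A_props(1) by (simp add: parallel_step_def Let_def)
  have "{\<omega>. (j, \<omega>) \<in> parallel_T A \<alpha> r} = (if j \<in> resolvable ?S then {x $ j} else {})" if "j < n" for j
    using column_T_eq[OF c that] that A_props(1) by (auto simp: parallel_T_def resolvable_def)
  then have x: "?x $ j = (if j \<in> resolvable ?S then x $ j else xh $ j)" if "j < n" for j
    using that zero[of j] by (auto simp: resolvable_def)
  have "resolvable ?S \<subseteq> ?S" by (auto simp: resolvable_def)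
  from resolve[OF c this vec_carrier x]
  show "consistent (parallel_step A y \<alpha> (xh, r))"
    "unresolved (fst (parallel_step A y \<alpha> (xh, r))) = ?S - resolvable ?S"
    unfolding step fst_conv by auto
qed

lemma serial_update_resolves:
  assumes c: "consistent (xh, r)" and j: "j < n"
  shows "consistent (serial_update A y \<alpha> j (xh, r))"
    "unresolved (fst (serial_update A y \<alpha> j (xh, r))) = unresolved xh - {j} \<inter> resolvable (unresolved xh)"
proof -
  let ?S = "unresolved xh"
  let ?x = "vec n (\<lambda>i. if i = j then xh $ i + (\<Sum>\<omega>\<in>column_T A \<alpha> r j. \<omega>) else xh $ i)"
  have zero: "xh $ j = 0" if "j \<in> ?S" using c that by (auto simp: consistent_def)
  have step: "serial_update A y \<alpha> j (xh, r) = (?x, y - A *\<^sub>v ?x)"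
    using A_props(1) by (simp add: serial_update_def Let_def)
  have x: "?x $ i = (if i \<in> {j} \<inter> resolvable ?S then x $ i else xh $ i)" if "i < n" for i
    using that zero column_T_eq[OF c j] by (auto simp: resolvable_def)
  have "{j} \<inter> resolvable ?S \<subseteq> ?S" by (auto simp: resolvable_def)
  from resolve[OF c this vec_carrier x]
  show "consistent (serial_update A y \<alpha> j (xh, r))"
    "unresolved (fst (serial_update A y \<alpha> j (xh, r))) = ?S - {j} \<inter> resolvable ?S"
    unfolding step fst_conv by auto
qed

text \<open>Induction over the processed columns, always comparing with the resolvable set at the
  start of the sweep. Only an inclusion holds, since further nodes may become resolvable on the
  way.\<close>

lemma serial_step_resolves:
  assumes c: "consistent (xh, r)"
  shows "consistent (serial_step A y \<alpha> (xh, r))"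
    "unresolved (fst (serial_step A y \<alpha> (xh, r))) \<subseteq> unresolved xh - resolvable (unresolved xh)"
proof -
  let ?f = "\<lambda>l. fold (serial_update A y \<alpha>) [0..<l] (xh, r)"
  have "consistent (?f l) \<and> unresolved (fst (?f l)) \<subseteq> unresolved xh - {..<l} \<inter> resolvable (unresolved xh)"
    if "l \<le> n" for l
    using that
  proof (induction l)
    case 0
    show ?case using c by simp
  next
    case (Suc l)
    obtain xl rl where l: "?f l = (xl, rl)" by fastforce
    have IH: "consistent (xl, rl)" "unresolved xl \<subseteq> unresolved xh - {..<l} \<inter> resolvable (unresolved xh)"
      using Suc l by auto
    have "?f (Suc l) = serial_update A y \<alpha> l (xl, rl)" by (simp add: l)
    moreover have "l < n" using Suc.prems by simp
    note serial_update_resolves[OF IH(1) this]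
    moreover have "l \<in> resolvable (unresolved xl)"
      if "l \<in> resolvable (unresolved xh)" "l \<in> unresolved xl"
      using resolvable_mono[OF that] IH(2) by auto
    ultimately show ?case using IH(2) by (auto simp: less_Suc_eq)
  qed
  from this[of n] have f: "consistent (?f n)"
    "unresolved (fst (?f n)) \<subseteq> unresolved xh - {..<n} \<inter> resolvable (unresolved xh)" by auto
  have "{..<n} \<inter> resolvable (unresolved xh) = resolvable (unresolved xh)"
    by (auto simp: resolvable_def unresolved_def)
  with f show "consistent (serial_step A y \<alpha> (xh, r))"
    "unresolved (fst (serial_step A y \<alpha> (xh, r))) \<subseteq> unresolved xh - resolvable (unresolved xh)"
    using A_props(1) by (auto simp: serial_step_def)
qed

text \<open>The interface between sweeps and iteration: termination, recovery and the sweep count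
  for both algorithms are derived from it.\<close>

definition contracting :: "(real vec \<times> real vec \<Rightarrow> real vec \<times> real vec) \<Rightarrow> bool" where
  "contracting step \<longleftrightarrow> (\<forall>s. consistent s \<longrightarrow> consistent (step s) \<and>
     real (card (unresolved (fst (step s)))) \<le> contraction \<epsilon> d * real (card (unresolved (fst s))))"

lemma contracting_steps: "contracting (parallel_step A y \<alpha>)" "contracting (serial_step A y \<alpha>)"
proof -
  show "contracting (parallel_step A y \<alpha>)"
    unfolding contracting_def
    using parallel_step_resolves card_unresolvable_le by fastforce
  have "real (card (unresolved (fst (serial_step A y \<alpha> (xh, r))))) \<le> contraction \<epsilon> d * real (card (unresolved xh))"
    if "consistent (xh, r)" for xh r
    using card_mono[OF _ serial_step_resolves(2)[OF that]] finite_unresolved[of xh]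
      card_unresolvable_le[OF that] by fastforce
  then show "contracting (serial_step A y \<alpha>)"
    unfolding contracting_def using serial_step_resolves(1) by auto
qed

text \<open>An unresolved node has a neighbour since d > 0, and the residual there is a nonempty
  subset sum, nonzero by dissociation. Hence the stopping test certifies recovery of
  \<open>x\<close> itself.\<close>

lemma residual_zero_iff:
  assumes c: "consistent (xh, r)"
  shows "r = 0\<^sub>v m \<longleftrightarrow> unresolved xh = {}" "r = 0\<^sub>v m \<longleftrightarrow> xh = x"
proof -
  have xh: "xh \<in> carrier_vec n" using consistent_carrier[OF c] by simp
  show *: "r = 0\<^sub>v m \<longleftrightarrow> unresolved xh = {}"
  proof
    assume "unresolved xh = {}"
    then show "r = 0\<^sub>v m"
      using residual_entry[OF c] consistent_carrier(2)[OF c] by auto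
  next
    assume r: "r = 0\<^sub>v m"
    show "unresolved xh = {}"
    proof (rule ccontr)
      assume "unresolved xh \<noteq> {}"
      then obtain j where j: "j \<in> unresolved xh" by auto
      then have "card (E `` {j}) > 0"
        using expander_props(1)[OF expander, of j] d_pos by (simp add: unresolved_def)
      then obtain i where i: "i \<in> E `` {j}" by (metis card_gt_0_iff ex_in_conv)
      then have "i < m" using expander_props(2)[OF expander, of "{j}"] by auto
      then show False
        using residual_entry_eq_iff[OF c _ empty_subsetI, of i] r j i by auto
    qed
  qed
  show "r = 0\<^sub>v m \<longleftrightarrow> xh = x"
    unfolding * using xh x_carrier by (auto simp: unresolved_def)
qed

end

section \<open>Iterating a contracting sweep\<close>

text \<open>Since \<phi> takes natural values, contraction by \<rho> < 1 forces strict decrease and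
  termination. The last conclusion limits N: the final execution of the body began with \<phi> \<ge>
  1 after N - 1 contractions.\<close>

lemma while_counted_contracting:
  fixes \<phi> :: "'s \<Rightarrow> nat" and \<rho> :: real
  assumes I: "I s" and step: "\<And>s. I s \<Longrightarrow> fst (test s) \<Longrightarrow> I (fst (body s))"
    and contract: "\<And>s. I s \<Longrightarrow> fst (test s) \<Longrightarrow> real (\<phi> (fst (body s))) \<le> \<rho> * real (\<phi> s)"
    and pos: "\<And>s. I s \<Longrightarrow> fst (test s) \<Longrightarrow> 0 < \<phi> s"
    and cost: "\<And>s. I s \<Longrightarrow> snd (test s) + snd (body s) \<le> b"
    and \<rho>: "0 < \<rho>" "\<rho> < 1"
  obtains s' N t where "while_counted test body s = Some (s', N, t)" "I s'" "\<not> fst (test s')"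
    "t \<le> (N + 1) * b" "N = 0 \<or> 1 \<le> \<rho> ^ (N - 1) * real (\<phi> s)"
proof -
  define J where "J = (\<lambda>(s', N, t). I s' \<and> real (\<phi> s') \<le> \<rho> ^ N * real (\<phi> s) \<and> t \<le> N * b
    \<and> (N = 0 \<or> 1 \<le> \<rho> ^ (N - 1) * real (\<phi> s)))"
  define B where "B = (\<lambda>(s, N :: nat, t). (fst (body s), N + 1, t + snd (test s) + snd (body s)))"
  define C where "C = (\<lambda>(s, N :: nat, t :: nat). fst (test s))"
  have J0: "J (s, 0, 0)" using I by (simp add: J_def)
  have J: "J (B p) \<and> \<phi> (fst (B p)) < \<phi> (fst p)" if Jp: "J p" and Cp: "C p" for p
  proof -
    obtain s' N t where p: "p = (s', N, t)" by (cases p)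
    have *: "I s'" "real (\<phi> s') \<le> \<rho> ^ N * real (\<phi> s)" "t \<le> N * b" "fst (test s')"
      using Jp Cp by (auto simp: p J_def C_def)
    note ct = contract[OF *(1,4)] and ps = pos[OF *(1,4)]
    note ct
    also have "\<rho> * real (\<phi> s') \<le> \<rho> * (\<rho> ^ N * real (\<phi> s))"
      using \<rho> *(2) by (intro mult_left_mono) auto
    finally have "real (\<phi> (fst (body s'))) \<le> \<rho> ^ (N + 1) * real (\<phi> s)" by simp
    moreover have "1 \<le> \<rho> ^ N * real (\<phi> s)" using *(2) ps by linarith
    moreover have "\<rho> * real (\<phi> s') < 1 * real (\<phi> s')" using \<rho> ps by (intro mult_strict_right_mono) auto
    then have "\<phi> (fst (body s')) < \<phi> s'" using ct by linarith
    moreover have "t + snd (test s') + snd (body s') \<le> (N + 1) * b"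
      using *(3) cost[OF *(1)] by simp
    ultimately show ?thesis using step[OF *(1,4)] by (simp add: p B_def J_def)
  qed
  have "\<exists>q. while_option C B (s, 0, 0) = Some q"
    by (rule measure_while_option_Some[where P = J and f = "\<lambda>p. \<phi> (fst p)"]) (use J J0 in auto)
  then obtain s' N t where q: "while_option C B (s, 0, 0) = Some (s', N, t)" by auto
  have Jq: "J (s', N, t)"
    by (rule while_option_rule[OF _ q, where P = J]) (use J J0 in auto)
  have stop: "\<not> fst (test s')" using while_option_stop[OF q] by (simp add: C_def)
  have "while_counted test body s = Some (s', N, t + snd (test s'))"
    using q unfolding while_counted_def B_def C_def by simp
  \<comment> \<open>The extra \<open>b\<close> pays for the final, failing test.\<close>
  moreover have "t + snd (test s') \<le> (N + 1) * b"
    using Jq cost[of s'] by (simp add: J_def)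
  ultimately show ?thesis using that stop Jq by (simp add: J_def)
qed

text \<open>From 1 \<le> \<rho>^(N - 1) k one gets N - 1 \<le> ln k / (- ln \<rho>); the missing 1
  is at most ln k / ln 2 for k \<ge> 2.\<close>

definition sweep_factor :: "real \<Rightarrow> real" where
  "sweep_factor \<rho> = 1 / ln 2 + 1 / - ln \<rho>"

lemma sweeps_le:
  assumes \<rho>: "0 < \<rho>" "\<rho> < 1" and k: "2 \<le> k" "l \<le> k"
    and N: "N = 0 \<or> 1 \<le> \<rho> ^ (N - 1) * real l"
  shows "real N \<le> sweep_factor \<rho> * ln (real k)"
proof -
  have lnr: "0 < - ln \<rho>" using \<rho> by (simp add: ln_less_zero)
  have lnk: "ln 2 \<le> ln (real k)" "0 < ln (2::real)" "0 \<le> ln (real k)" using k by auto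
  show ?thesis
  proof (cases "N = 0")
    case True
    have "0 \<le> 1 / ln 2 + 1 / - ln \<rho>" using lnr lnk by (intro add_nonneg_nonneg) auto
    then show ?thesis unfolding sweep_factor_def using True lnk(3) by (intro order.trans[OF _ mult_nonneg_nonneg]) auto
  next
    case False
    then have "1 \<le> \<rho> ^ (N - 1) * real l" using N by simp
    also have "\<dots> \<le> \<rho> ^ (N - 1) * real k" using \<rho> k by (intro mult_left_mono) auto
    finally have "ln 1 \<le> ln (\<rho> ^ (N - 1) * real k)" using \<rho> k by (subst ln_le_cancel_iff) auto
    also have "\<dots> = real (N - 1) * ln \<rho> + ln (real k)"
      using \<rho> k by (simp add: ln_mult ln_realpow)
    finally have "real (N - 1) * - ln \<rho> \<le> ln (real k)" by simp
    then have "real (N - 1) \<le> 1 / - ln \<rho> * ln (real k)"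
      by (simp only: times_divide_eq_left mult_1 pos_le_divide_eq[OF lnr])
    moreover have "1 \<le> 1 / ln 2 * ln (real k)" using lnk by simp
    ultimately show ?thesis
      unfolding sweep_factor_def distrib_right using False by linarith
  qed
qed

section \<open>Operation counts\<close>

lemma snd_counted [simp]:
  "snd (ret v) = 0" "snd (tick v) = 1" "snd (bind_counted p f) = snd p + snd (f (fst p))"
  "snd (read_at a i) = 1" "snd (write_at a i v) = 1" "snd (add u w) = 1" "snd (sub u' w') = 1"
  "snd (equal b c) = 1" "snd (leq e g) = 1" "snd (new_array n v) = n" "snd (copy a) = length a"
  by (simp_all add: ret_def tick_def bind_counted_def read_at_def write_at_def add_def sub_def
      equal_def leq_def new_array_def copy_def)

text \<open>Each round pays one operation for the loop itself, and the exhausted list costs one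
  more.\<close>

lemma snd_for_each_le:
  "(\<And>a s. a \<in> set as \<Longrightarrow> snd (f a s) \<le> b) \<Longrightarrow> snd (for_each as f s) \<le> length as * (b + 1) + 1"
proof (induction as arbitrary: s)
  case (Cons a as)
  have "snd (f a s) \<le> b" "snd (for_each as f (fst (f a s))) \<le> length as * (b + 1) + 1"
    using Cons by auto
  then show ?case by simp
qed simp

lemma snd_majority_le: "snd (majority r is) \<le> 5 * length is + 1"
proof -
  have "snd (majority r is) \<le> length is * (4 + 1) + 1"
    unfolding majority_def by (rule snd_for_each_le) (auto split: prod.splits)
  then show ?thesis by simp
qed

lemma snd_passes_le: "snd (passes r \<alpha> is \<omega>) \<le> 6 * length is + 2"
proof -
  have "snd (score r is \<omega>) \<le> length is * (5 + 1) + 1"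
    unfolding score_def by (rule snd_for_each_le) auto
  then show ?thesis by (simp add: passes_def)
qed

text \<open>The factor is 17 = 5 + 6 + 6: one vote and the scores of two candidates.\<close>

lemma snd_column_scan_le: "snd (column_scan r \<alpha> is) \<le> 17 * length is + 9"
proof (cases "is")
  case (Cons i js)
  show ?thesis
    using snd_majority_le[of r js] snd_passes_le[of r \<alpha> "is" "r ! i"]
      snd_passes_le[of r \<alpha> "is" "fst (fst (majority r js))"]
    by (auto simp: Cons column_scan_def split: prod.splits)
qed (simp add: column_scan_def)

lemma length_column_scan_le: "length (fst (column_scan r \<alpha> is)) \<le> 2"
  by (auto simp: column_scan_def split: list.splits prod.splits)

lemma snd_subtract_at_le: "snd (subtract_at r is v) \<le> 4 * length is + 1"
proof -
  have "snd (subtract_at r is v) \<le> length is * (3 + 1) + 1"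
    unfolding subtract_at_def by (rule snd_for_each_le) auto
  then show ?thesis by simp
qed

lemma snd_nonzero_le: "snd (nonzero r) \<le> 2 * length r + 1"
proof -
  have "snd (nonzero r) \<le> length r * (1 + 1) + 1"
    unfolding nonzero_def by (rule snd_for_each_le) auto
  then show ?thesis by simp
qed

lemma fst_nonzero: "fst (nonzero r) \<longleftrightarrow> (\<exists>i<length r. r ! i \<noteq> 0)"
proof -
  have "fold (\<lambda>v b. if v = 0 then b else True) r b \<longleftrightarrow> b \<or> (\<exists>v\<in>set r. v \<noteq> 0)" for b
    by (induction r arbitrary: b) auto
  moreover have "(\<lambda>v b. fst (do { z \<leftarrow> equal v 0; if z then ret b else ret True }))
      = (\<lambda>v b. if v = (0 :: real) then b else True)"
    by (intro ext) simp
  ultimately have "fst (nonzero r) \<longleftrightarrow> (\<exists>v\<in>set r. v \<noteq> 0)" by (simp add: nonzero_def)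
  then show ?thesis by (metis in_set_conv_nth)
qed

lemma snd_residual_le:
  assumes "\<And>is. is \<in> set cs \<Longrightarrow> length is \<le> d"
  shows "snd (residual cs y xs) \<le> length y + length cs * (4 * d + 4) + 1"
proof -
  have "snd (for_each [0..<length cs] (\<lambda>j r. do {
       is \<leftarrow> read_at cs j;
       v \<leftarrow> read_at xs j;
       subtract_at r is v }) y) \<le> length [0..<length cs] * ((4 * d + 3) + 1) + 1"
  proof (rule snd_for_each_le)
    fix j and r :: "real list" assume "j \<in> set [0..<length cs]"
    then have "length (cs ! j) \<le> d" using assms by simp
    then show "snd (do { is \<leftarrow> read_at cs j; v \<leftarrow> read_at xs j; subtract_at r is v }) \<le> 4 * d + 3"
      using snd_subtract_at_le[of r "cs ! j" "xs ! j"] by simp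
  qed
  then show ?thesis by (simp add: residual_def algebra_simps)
qed

lemma length_fold_le:
  "(\<And>a xs. a \<in> set as \<Longrightarrow> length (f a xs) \<le> length xs + b) \<Longrightarrow>
    length (fold f as xs) \<le> length xs + length as * b"
proof (induction as arbitrary: xs)
  case (Cons a as)
  have "length (f a xs) \<le> length xs + b" "length (fold f as (f a xs)) \<le> length (f a xs) + length as * b"
    using Cons by auto
  then show ?case by simp
qed simp

lemma snd_parallel_sweep_le:
  assumes cs: "\<And>is. is \<in> set cs \<Longrightarrow> length is \<le> d" and "0 < d" "length y < length cs"
  shows "snd (parallel_sweep cs y \<alpha> (xs, r)) \<le> 60 * (d * length cs)"
proof -
  let ?n = "length cs"
  define f where "f = (\<lambda>j T. do {
            is \<leftarrow> read_at cs j;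
            ws \<leftarrow> column_scan r \<alpha> is;
            for_each ws (\<lambda>\<omega> T. tick ((j, \<omega>) # T)) T })"
  define T where "T = fst (for_each [0..<?n] f [])"
  define xs' where "xs' = fst (for_each T (\<lambda>(j, \<omega>) xs. add_at xs j \<omega>) xs)"
  have f: "snd (f j S) \<le> 17 * d + 15" "length (fst (f j S)) \<le> length S + 2"
    if "j \<in> set [0..<?n]" for j S
  proof -
    let ?ws = "fst (column_scan r \<alpha> (cs ! j))"
    have ws: "length ?ws \<le> 2" by (rule length_column_scan_le)
    have "snd (for_each ?ws (\<lambda>\<omega> T. tick ((j, \<omega>) # T)) S) \<le> length ?ws * (1 + 1) + 1"
      by (rule snd_for_each_le) simp
    moreover have "length (cs ! j) \<le> d" using cs that by simp
    moreover note snd_column_scan_le[of r \<alpha> "cs ! j"]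
    ultimately show "snd (f j S) \<le> 17 * d + 15" using ws by (simp add: f_def)
    show "length (fst (f j S)) \<le> length S + 2" using ws by (simp add: f_def fold_Cons_pairs)
  qed
  have "snd (for_each [0..<?n] f []) \<le> length [0..<?n] * ((17 * d + 15) + 1) + 1"
    by (rule snd_for_each_le) (rule f(1))
  moreover have "length T \<le> 0 + length [0..<?n] * 2"
    unfolding T_def fst_for_each using length_fold_le[where xs = "[]"] f(2) by fastforce
  moreover have "snd (for_each T (\<lambda>(j, \<omega>) xs. add_at xs j \<omega>) xs) \<le> length T * (3 + 1) + 1"
    by (rule snd_for_each_le) (auto simp: add_at_def)
  moreover have "snd (residual cs y xs') \<le> length y + ?n * (4 * d + 4) + 1"
    by (rule snd_residual_le) (rule cs)
  moreover have "snd (parallel_sweep cs y \<alpha> (xs, r)) = snd (for_each [0..<?n] f [])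
      + snd (for_each T (\<lambda>(j, \<omega>) xs. add_at xs j \<omega>) xs) + snd (residual cs y xs')"
    by (simp add: parallel_sweep_def f_def[symmetric] T_def[symmetric] xs'_def[symmetric]
        del: fst_for_each)
  \<comment> \<open>Here 21 = 17 + 4 for scanning all columns and recomputing the residual. At most
    two updates per column, and copying \<open>y\<close> with fewer than \<open>?n\<close> entries,
    are linear in \<open>?n\<close>.\<close>
  ultimately have "snd (parallel_sweep cs y \<alpha> (xs, r)) \<le> 21 * (d * ?n) + 30 * ?n + 3"
    using assms(3) by (simp add: algebra_simps)
  moreover have "?n \<le> d * ?n" "0 < ?n" using assms(2,3) by auto
  ultimately show ?thesis by linarith
qed

lemma snd_serial_sweep_le:
  assumes cs: "\<And>is. is \<in> set cs \<Longrightarrow> length is \<le> d" and "0 < d" "0 < length cs"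
  shows "snd (serial_sweep cs y \<alpha> s) \<le> 60 * (d * length cs)"
proof -
  let ?n = "length cs"
  \<comment> \<open>Here 25 = 17 + 2 * 4: one scan and at most two incremental residual updates per
    column.\<close>
  have "snd (serial_sweep cs y \<alpha> s) \<le> length [0..<?n] * ((25 * d + 21) + 1) + 1"
    unfolding serial_sweep_def
  proof (rule snd_for_each_le)
    fix j and s :: "real list \<times> real list" assume j: "j \<in> set [0..<?n]"
    obtain xs r where s: "s = (xs, r)" by (cases s)
    let ?ws = "fst (column_scan r \<alpha> (cs ! j))"
    have len: "length (cs ! j) \<le> d" using cs j by simp
    have "snd (subtract_at r (cs ! j) \<omega>) \<le> 4 * d + 1" for r \<omega>
      using snd_subtract_at_le[of r "cs ! j" \<omega>] len by linarith
    then have "snd (for_each ?ws (\<lambda>\<omega> (xs, r). do {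
         xs' \<leftarrow> add_at xs j \<omega>;
         r' \<leftarrow> subtract_at r (cs ! j) \<omega>;
         ret (xs', r') }) (xs, r)) \<le> length ?ws * ((4 * d + 4) + 1) + 1" (is "?L \<le> _")
      by (intro snd_for_each_le) (auto simp: add_at_def)
    also have "\<dots> \<le> 2 * ((4 * d + 4) + 1) + 1"
      using length_column_scan_le[of r \<alpha> "cs ! j"] by (intro add_mono mult_right_mono) auto
    finally have "?L \<le> 2 * ((4 * d + 4) + 1) + 1" .
    then show "snd (case s of (xs, r) \<Rightarrow> do {
       is \<leftarrow> read_at cs j;
       ws \<leftarrow> column_scan r \<alpha> is;
       for_each ws (\<lambda>\<omega> (xs, r). do {
         xs' \<leftarrow> add_at xs j \<omega>;
         r' \<leftarrow> subtract_at r is \<omega>;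
         ret (xs', r') }) (xs, r) }) \<le> 25 * d + 21"
      using snd_column_scan_le[of r \<alpha> "cs ! j"] len by (simp add: s)
  qed
  then have "snd (serial_sweep cs y \<alpha> s) \<le> 25 * (d * ?n) + 22 * ?n + 1"
    by (simp add: algebra_simps)
  moreover have "?n \<le> d * ?n" using assms(2) by simp
  ultimately show ?thesis using assms(3) by linarith
qed

section \<open>Recovery\<close>

context sparse_recovery
begin

text \<open>While the residual is nonzero some coordinate is unresolved, so contraction strictly
  lowers their number; at the end \<open>residual_zero_iff\<close> identifies the estimate.\<close>

lemma decode_eq_x:
  assumes "contracting (step A y \<alpha>)"
  shows "decode step A y \<alpha> = Some x"
proof -
  let ?C = "\<lambda>(xh, r). r \<noteq> 0\<^sub>v m" and ?\<phi> = "\<lambda>s. card (unresolved (fst s))"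
  have dim: "dim_row A = m" "dim_col A = n" using A_props(1) by auto
  have step: "consistent (step A y \<alpha> s) \<and> ?\<phi> (step A y \<alpha> s) < ?\<phi> s" if s: "consistent s" "?C s" for s
  proof -
    have "unresolved (fst s) \<noteq> {}" using s residual_zero_iff(1) by (cases s) auto
    then have "0 < ?\<phi> s" using finite_unresolved by (simp add: card_gt_0_iff)
    then have "contraction \<epsilon> d * real (?\<phi> s) < 1 * real (?\<phi> s)"
      using contraction_bounds(2)[OF eps_pos d_pos] by (intro mult_strict_right_mono) auto
    moreover have "consistent (step A y \<alpha> s) \<and> real (?\<phi> (step A y \<alpha> s)) \<le> contraction \<epsilon> d * real (?\<phi> s)"
      using assms s(1) unfolding contracting_def by blast
    ultimately show ?thesis by linarith
  qed
  have "\<exists>s. while_option ?C (step A y \<alpha>) (0\<^sub>v n, y) = Some s"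
    by (rule measure_while_option_Some[where P = consistent and f = ?\<phi>])
      (use step consistent_initial in auto)
  then obtain xh r where w: "while_option ?C (step A y \<alpha>) (0\<^sub>v n, y) = Some (xh, r)" by auto
  have "consistent (xh, r)"
    by (rule while_option_rule[OF _ w, where P = consistent]) (use step consistent_initial in auto)
  moreover have "r = 0\<^sub>v m" using while_option_stop[OF w] by simp
  ultimately have "xh = x" using residual_zero_iff(2) by auto
  then show ?thesis using w by (simp add: decode_def dim)
qed

lemma decode_counted_bounds:
  assumes step: "contracting step"
    and refines: "\<And>xh r. consistent (xh, r) \<Longrightarrow> map_prod vec_of_list vec_of_list
       (fst (sweep (columns A) (list_of_vec y) \<alpha> (list_of_vec xh, list_of_vec r))) = step (xh, r)"
    and cost: "\<And>s. snd (sweep (columns A) (list_of_vec y) \<alpha> s) \<le> 60 * (d * n)"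
  shows "\<exists>N t. decode_counted sweep A y \<alpha> = Some (x, N, t) \<and>
    real t \<le> 100 * (real d * real n) * (real N + 1) \<and>
    real N \<le> sweep_factor (contraction \<epsilon> d) * ln (real k)"
proof -
  have dim: "dim_col A = n" "dim_vec y = m" using A_props(1) y_carrier by auto
  \<comment> \<open>The program runs on lists; invariant and measure are pulled back along
    \<open>?v\<close>.\<close>
  let ?v = "map_prod vec_of_list vec_of_list :: real list \<times> real list \<Rightarrow> real vec \<times> real vec"
  let ?I = "\<lambda>s. consistent (?v s)" and ?\<phi> = "\<lambda>s. card (unresolved (fst (?v s)))"
  let ?test = "\<lambda>(xs :: real list, r). nonzero r"
  let ?body = "sweep (columns A) (list_of_vec y) \<alpha>" and ?s = "(replicate n 0, list_of_vec y)"
  have test: "fst (?test s) \<longleftrightarrow> unresolved (fst (?v s)) \<noteq> {}" "fst (?test s) \<longleftrightarrow> fst (?v s) \<noteq> x"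
    "snd (?test s) \<le> 2 * m + 1" if I: "?I s" for s
  proof -
    obtain xs r where s: "s = (xs, r)" by (cases s)
    have c: "consistent (vec_of_list xs, vec_of_list r)" using I by (simp only: s map_prod_simp)
    then have len: "length r = m" using carrier_vecD[OF consistent_carrier(2)] by fastforce
    then have "fst (nonzero r) \<longleftrightarrow> vec_of_list r \<noteq> 0\<^sub>v m"
      by (auto simp: fst_nonzero vec_eq_iff vec_of_list_index)
    then show "fst (?test s) \<longleftrightarrow> unresolved (fst (?v s)) \<noteq> {}"
      "fst (?test s) \<longleftrightarrow> fst (?v s) \<noteq> x" "snd (?test s) \<le> 2 * m + 1"
      using residual_zero_iff[OF c] snd_nonzero_le[of r] by (simp_all add: s len)
  qed
  have body: "?v (fst (?body s)) = step (?v s)" if "?I s" for s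
    using refines[of "vec_of_list (fst s)" "vec_of_list (snd s)"] that
    by (cases s) (simp add: list_vec)
  have s0: "?v ?s = (0\<^sub>v n, y)"
    by (auto simp: vec_list vec_of_list_index)
  \<comment> \<open>By m < n the test costs at most 2 n; with the 60 d n of a sweep this gives the
    62 d n per round used below.\<close>
  have n: "2 * m + 1 \<le> 2 * n" "n \<le> d * n" using m_less_n d_pos by auto
  obtain s N t where w: "while_counted ?test ?body ?s = Some (s, N, t)" "?I s" "\<not> fst (?test s)"
    "t \<le> (N + 1) * (62 * (d * n))" "N = 0 \<or> 1 \<le> contraction \<epsilon> d ^ (N - 1) * real (?\<phi> ?s)"
  proof (rule while_counted_contracting[of ?I ?s ?test ?body ?\<phi> "contraction \<epsilon> d" "62 * (d * n)"])
    show "?I ?s" unfolding s0 by (rule consistent_initial)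
    fix s assume I: "?I s"
    then show "?I (fst (?body s))" "real (?\<phi> (fst (?body s))) \<le> contraction \<epsilon> d * real (?\<phi> s)"
      using step unfolding body[OF I] contracting_def by blast+
    show "0 < ?\<phi> s" if "fst (?test s)"
      using that test(1)[OF I] finite_unresolved by (simp add: card_gt_0_iff)
    show "snd (?test s) + snd (?body s) \<le> 62 * (d * n)"
      using test(3)[OF I] cost[of s] n by linarith
  qed (use contraction_bounds[OF eps_pos d_pos] in auto)
  obtain xs r where s: "s = (xs, r)" by (cases s)
  have "vec_of_list xs = x" using test(2)[OF w(2)] w(3) by (simp add: s)
  then have "decode_counted sweep A y \<alpha> = Some (x, N, n + m + t)"
    using w(1) unfolding decode_counted_def dim
    by (simp add: ret_def new_array_def copy_def bind_counted_def s dim)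
  \<comment> \<open>Here 100 = 62 + 38, the second summand generously covering the initialisation
    cost n + m.\<close>
  moreover have "n + m + t \<le> 100 * (d * n) * (N + 1)"
  proof -
    have "n + m \<le> 2 * (d * n)" using n by linarith
    also have "\<dots> \<le> 38 * (d * n) * (N + 1)" by simp
    finally show ?thesis using w(4) by (simp add: algebra_simps)
  qed
  then have "real (n + m + t) \<le> real (100 * (d * n) * (N + 1))" by (simp only: of_nat_le_iff)
  then have "real (n + m + t) \<le> 100 * (real d * real n) * (real N + 1)"
    by (simp only: of_nat_mult of_nat_add of_nat_numeral of_nat_1)
  moreover have \<phi>: "?\<phi> ?s \<le> k"
    using card_unresolved_le[OF consistent_initial] by (simp only: s0 fst_conv)
  have "real N \<le> sweep_factor (contraction \<epsilon> d) * ln (real k)"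
    by (rule sweeps_le[OF contraction_bounds[OF eps_pos d_pos] k_ge \<phi> w(5)])
  ultimately show ?thesis by blast
qed

lemma columns_list: "length (columns A) = n" "is \<in> set (columns A) \<Longrightarrow> length is \<le> d"
  using columns_props(1)[OF A_props(1)] length_columns by (auto simp: in_set_conv_nth)

lemma serial_recovers:
  "serial_l0 A y \<alpha> = Some x"
  "\<exists>N t. serial_l0_counted A y \<alpha> = Some (x, N, t) \<and>
    real t \<le> 100 * (real d * real n) * (real N + 1) \<and>
    real N \<le> sweep_factor (contraction \<epsilon> d) * ln (real k)"
proof -
  show "serial_l0 A y \<alpha> = Some x"
    unfolding serial_l0_def by (rule decode_eq_x[where step = serial_step, OF contracting_steps(2)])
  show "\<exists>N t. serial_l0_counted A y \<alpha> = Some (x, N, t) \<and>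
      real t \<le> 100 * (real d * real n) * (real N + 1) \<and>
      real N \<le> sweep_factor (contraction \<epsilon> d) * ln (real k)"
    unfolding serial_l0_counted_def
  proof (rule decode_counted_bounds[OF contracting_steps(2)])
    \<comment> \<open>The incremental residual is right only if it starts as
      \<open>y - A *\<^sub>v xh\<close>, which the invariant supplies.\<close>
    show "map_prod vec_of_list vec_of_list
        (fst (serial_sweep (columns A) (list_of_vec y) \<alpha> (list_of_vec xh, list_of_vec r)))
        = serial_step A y \<alpha> (xh, r)" if "consistent (xh, r)" for xh r
      using that by (intro serial_sweep_refines[OF A_props y_carrier _ _ alpha_pos column_length_le])
        (auto simp: consistent_def)
    show "snd (serial_sweep (columns A) (list_of_vec y) \<alpha> s) \<le> 60 * (d * n)" for s
      using snd_serial_sweep_le[of "columns A" d] columns_list d_pos m_less_n by simp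
  qed
qed

lemma parallel_recovers:
  "parallel_l0 A y \<alpha> = Some x"
  "\<exists>N t. parallel_l0_counted A y \<alpha> = Some (x, N, t) \<and>
    real t \<le> 100 * (real d * real n) * (real N + 1) \<and>
    real N \<le> sweep_factor (contraction \<epsilon> d) * ln (real k)"
proof -
  show "parallel_l0 A y \<alpha> = Some x"
    unfolding parallel_l0_def by (rule decode_eq_x[where step = parallel_step, OF contracting_steps(1)])
  show "\<exists>N t. parallel_l0_counted A y \<alpha> = Some (x, N, t) \<and>
      real t \<le> 100 * (real d * real n) * (real N + 1) \<and>
      real N \<le> sweep_factor (contraction \<epsilon> d) * ln (real k)"
    unfolding parallel_l0_counted_def
  proof (rule decode_counted_bounds[OF contracting_steps(1)])
    show "map_prod vec_of_list vec_of_list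
        (fst (parallel_sweep (columns A) (list_of_vec y) \<alpha> (list_of_vec xh, list_of_vec r)))
        = parallel_step A y \<alpha> (xh, r)" if "consistent (xh, r)" for xh r
      using consistent_carrier[OF that]
      by (intro parallel_sweep_refines[OF A_props y_carrier _ _ alpha_pos column_length_le])
    show "snd (parallel_sweep (columns A) (list_of_vec y) \<alpha> s) \<le> 60 * (d * n)" for s
    proof -
      have "length (list_of_vec y) < length (columns A)"
        using carrier_vecD[OF y_carrier] m_less_n columns_list(1) by simp
      from snd_parallel_sweep_le[OF columns_list(2) d_pos this] show ?thesis
        unfolding columns_list(1) by (metis surj_pair)
    qed
  qed
qed

end

text \<open>The quantifier order carries the content of the O-notation: \<open>c\<close> is
  absolute, while \<open>C\<close> depends only on \<epsilon> and d. The cost per sweep and the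
  number of sweeps are bounded separately as well.\<close>

theorem theoremI2:
  shows "\<exists>c::real. \<forall>(\<epsilon>::real) (d::nat). 0 < \<epsilon> \<longrightarrow> \<epsilon> \<le> 1/4 \<longrightarrow>
    (\<exists>C::real. \<forall>(k::nat) (m::nat) (n::nat) E A (x::real vec) y \<alpha>.
       2 \<le> k \<longrightarrow>
       expander m n E k \<epsilon> d \<longrightarrow>
       A = adjacency_matrix m n E \<longrightarrow>
       x \<in> carrier_vec n \<longrightarrow>
       dissociated x \<longrightarrow>
       l0 x \<le> k \<longrightarrow>
       l0 x < m \<longrightarrow>
       y = A *\<^sub>v x \<longrightarrow>
       \<alpha> = (1 - 2 * \<epsilon>) * real d \<longrightarrow>
         serial_l0 A y \<alpha> = Some x \<and>
         parallel_l0 A y \<alpha> = Some x \<and>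
         (\<exists>N t. serial_l0_counted A y \<alpha> = Some (x, N, t) \<and>
            real t \<le> C * (real d * real n * ln (real k)) \<and>
            real t \<le> c * (real d * real n) * (real N + 1) \<and>
            real N \<le> C * ln (real k)) \<and>
         (\<exists>N t. parallel_l0_counted A y \<alpha> = Some (x, N, t) \<and>
            real t \<le> C * (real d * real n * ln (real k)) \<and>
            real t \<le> c * (real d * real n) * (real N + 1) \<and>
            real N \<le> C * ln (real k)))"
proof (rule exI[of _ 100], intro allI impI)
  fix \<epsilon> :: real and d :: nat
  assume eps: "0 < \<epsilon>" "\<epsilon> \<le> 1/4"
  define F where "F = sweep_factor (contraction \<epsilon> d)"
  \<comment> \<open>\<open>F\<close> bounds the sweeps. The other entry bounds the operations, where
    1 \<le> ln k / ln 2 absorbs the summand 1 of N + 1.\<close>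
  define C where "C = max F (100 * (F + 1 / ln 2))"
  have bounds: "real t \<le> C * (real d * real n * ln (real k)) \<and>
      real t \<le> 100 * (real d * real n) * (real N + 1) \<and> real N \<le> C * ln (real k)"
    if "2 \<le> k" and t: "real t \<le> 100 * (real d * real n) * (real N + 1)"
      and N: "real N \<le> F * ln (real k)" for t d n N k :: nat
  proof -
    have ln: "0 < ln (2::real)" "ln 2 \<le> ln (real k)" "0 \<le> ln (real k)" using \<open>2 \<le> k\<close> by auto
    then have "1 \<le> 1 / ln 2 * ln (real k)" by simp
    then have "real N + 1 \<le> (F + 1 / ln 2) * ln (real k)"
      unfolding distrib_right using N by linarith
    then have "100 * (real d * real n) * (real N + 1)
      \<le> 100 * (real d * real n) * ((F + 1 / ln 2) * ln (real k))"
      by (intro mult_left_mono) auto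
    also have "\<dots> = 100 * (F + 1 / ln 2) * (real d * real n * ln (real k))" by (simp add: mult_ac)
    also have "\<dots> \<le> C * (real d * real n * ln (real k))"
      using ln by (intro mult_right_mono) (auto simp: C_def)
    finally have "real t \<le> C * (real d * real n * ln (real k))" using t by linarith
    moreover have "F * ln (real k) \<le> C * ln (real k)"
      using ln by (intro mult_right_mono) (auto simp: C_def)
    ultimately show ?thesis using t N by linarith
  qed
  show "\<exists>C::real. \<forall>(k::nat) (m::nat) (n::nat) E A (x::real vec) y \<alpha>.
       2 \<le> k \<longrightarrow>
       expander m n E k \<epsilon> d \<longrightarrow>
       A = adjacency_matrix m n E \<longrightarrow>
       x \<in> carrier_vec n \<longrightarrow>
       dissociated x \<longrightarrow>
       l0 x \<le> k \<longrightarrow>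
       l0 x < m \<longrightarrow>
       y = A *\<^sub>v x \<longrightarrow>
       \<alpha> = (1 - 2 * \<epsilon>) * real d \<longrightarrow>
         serial_l0 A y \<alpha> = Some x \<and>
         parallel_l0 A y \<alpha> = Some x \<and>
         (\<exists>N t. serial_l0_counted A y \<alpha> = Some (x, N, t) \<and>
            real t \<le> C * (real d * real n * ln (real k)) \<and>
            real t \<le> 100 * (real d * real n) * (real N + 1) \<and>
            real N \<le> C * ln (real k)) \<and>
         (\<exists>N t. parallel_l0_counted A y \<alpha> = Some (x, N, t) \<and>
            real t \<le> C * (real d * real n * ln (real k)) \<and>
            real t \<le> 100 * (real d * real n) * (real N + 1) \<and>
            real N \<le> C * ln (real k))"
  proof (rule exI[of _ C], intro allI impI)
    fix k m n :: nat and E A and x y :: "real vec" and \<alpha> :: real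
    assume k: "2 \<le> k" and E: "expander m n E k \<epsilon> d" and A: "A = adjacency_matrix m n E"
      and x: "x \<in> carrier_vec n" "dissociated x" "l0 x \<le> k"
      and y: "y = A *\<^sub>v x" and \<alpha>: "\<alpha> = (1 - 2 * \<epsilon>) * real d"
    interpret S: sparse_recovery m n k d E \<epsilon> x
      using k E eps x by unfold_locales
    have [simp]: "A = S.A" "y = S.y" "\<alpha> = S.\<alpha>"
      using A y \<alpha> by (simp_all add: S.A_def S.y_def S.\<alpha>_def)
    show "serial_l0 A y \<alpha> = Some x \<and>
         parallel_l0 A y \<alpha> = Some x \<and>
         (\<exists>N t. serial_l0_counted A y \<alpha> = Some (x, N, t) \<and>
            real t \<le> C * (real d * real n * ln (real k)) \<and>
            real t \<le> 100 * (real d * real n) * (real N + 1) \<and>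
            real N \<le> C * ln (real k)) \<and>
         (\<exists>N t. parallel_l0_counted A y \<alpha> = Some (x, N, t) \<and>
            real t \<le> C * (real d * real n * ln (real k)) \<and>
            real t \<le> 100 * (real d * real n) * (real N + 1) \<and>
            real N \<le> C * ln (real k))"
      using S.serial_recovers S.parallel_recovers bounds[OF k] unfolding F_def by simp blast
  qed
qed

end
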